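(* If $q>2$ is even, there is a unique equivalence class of non-trivial perfect $\mathbb{F}_q$-linear MSRD codes in $M_{3\times3}(\mathbb{F}_q)$, i.e. of $3$-dimensional $\mathbb{F}_q$-subspaces of symmetric $3\times3$ matrices over $\mathbb{F}_q$ in which every nonzero matrix has rank $3$; if $q$ is odd, there are exactly two such equivalence classes.
   Context: An $\mathbb{F}_q$-linear symmetric rank-distance code is an $\mathbb{F}_q$-subspace of the space of symmetric $3\times3$ matrices over $\mathbb{F}_q$, with minimum distance the minimum rank of its nonzero elements. For minimum distance $3$ the maximal dimension is $3$ (MSRD codes), and the non-trivial perfect $\mathbb{F}_q$-linear SRD codes in $M_{3\times3}(\mathbb{F}_q)$ are exactly these $3$-dimensional codes of minimum distance $3$. Two codes $C,C'$ are equivalent if $C'=\{AXB:X\in C\}$ for some $A,B\in\mathrm{GL}(3,q)$. *)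

theory Defs
  imports "HOL-Analysis.Analysis"
begin

text \<open>
  The library's \<^term>\<open>(*s)\<close> on \<open>'a^'n^'m\<close> takes scalars in \<open>'a^'n\<close>, so the \<open>'a\<close>-vector space
  structure on matrices is introduced here.
\<close>

definition mat_scale :: "'a::field \<Rightarrow> 'a^'n^'m \<Rightarrow> 'a^'n^'m" where
  "mat_scale c X = (\<chi> i j. c * X $ i $ j)"

interpretation matvs: vector_space "mat_scale :: 'a::field \<Rightarrow> 'a^'n^'m \<Rightarrow> 'a^'n^'m"
  by unfold_locales (simp_all add: mat_scale_def vec_eq_iff algebra_simps)

definition linear_srd_code :: "('a::field^3^3) set \<Rightarrow> bool" where
  "linear_srd_code C \<longleftrightarrow> matvs.subspace C \<and> (\<forall>X\<in>C. transpose X = X)"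

text \<open>
  The \<open>3\<close>-dimensional linear symmetric rank-distance codes of minimum distance \<open>3\<close>; for
  finite \<open>'a\<close> these are the non-trivial perfect linear codes of symmetric \<open>3 \<times> 3\<close> matrices.
\<close>

definition perfect_msrd_codes :: "('a::field^3^3) set set" where
  "perfect_msrd_codes =
    {C. linear_srd_code C \<and> matvs.dim C = 3 \<and> (\<forall>X\<in>C. X \<noteq> 0 \<longrightarrow> rank X = 3)}"

definition code_equivalent :: "('a::field^3^3) set \<Rightarrow> ('a^3^3) set \<Rightarrow> bool" where
  "code_equivalent C C' \<longleftrightarrow>
    (\<exists>A B. invertible A \<and> invertible B \<and> C' = {A ** X ** B | X. X \<in> C})"

definition perfect_msrd_equiv :: "(('a::field^3^3) set \<times> ('a^3^3) set) set" where
  "perfect_msrd_equiv =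
    {(C, C'). C \<in> perfect_msrd_codes \<and> C' \<in> perfect_msrd_codes \<and> code_equivalent C C'}"

lemma code_equivalent_refl: "code_equivalent C C"
  unfolding code_equivalent_def
  by (rule exI[of _ "mat 1"], rule exI[of _ "mat 1"]) (auto simp: invertible_def)

lemma code_equivalent_sym:
  assumes "code_equivalent C C'"
  shows "code_equivalent C' C"
proof -
  obtain A B where AB: "invertible A" "invertible B" and C': "C' = {A ** X ** B | X. X \<in> C}"
    using assms unfolding code_equivalent_def by blast
  obtain A' where A': "A ** A' = mat 1" "A' ** A = mat 1"
    using AB(1) unfolding invertible_def by blast
  obtain B' where B': "B ** B' = mat 1" "B' ** B = mat 1"
    using AB(2) unfolding invertible_def by blast
  have inv: "A' ** (A ** X ** B) ** B' = X" for X
  proof -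
    have "A' ** (A ** X ** B) ** B' = (A' ** A) ** X ** (B ** B')"
      by (simp only: matrix_mul_assoc)
    then show ?thesis by (simp add: A' B')
  qed
  have "C = {A' ** X ** B' | X. X \<in> C'}"
  proof -
    have "{A' ** X ** B' | X. X \<in> C'} = {A' ** (A ** X ** B) ** B' | X. X \<in> C}"
      unfolding C' by blast
    then show ?thesis by (simp add: inv)
  qed
  moreover have "invertible A'" "invertible B'"
    using A' B' unfolding invertible_def by blast+
  ultimately show ?thesis
    unfolding code_equivalent_def by blast
qed

lemma code_equivalent_trans:
  assumes "code_equivalent C C'" "code_equivalent C' C''"
  shows "code_equivalent C C''"
proof -
  obtain A B where AB: "invertible A" "invertible B" and C': "C' = {A ** X ** B | X. X \<in> C}"
    using assms(1) unfolding code_equivalent_def by blast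
  obtain P Q where PQ: "invertible P" "invertible Q" and C'': "C'' = {P ** X ** Q | X. X \<in> C'}"
    using assms(2) unfolding code_equivalent_def by blast
  have eq: "P ** (A ** X ** B) ** Q = (P ** A) ** X ** (B ** Q)" for X
    by (simp only: matrix_mul_assoc)
  have "C'' = {(P ** A) ** X ** (B ** Q) | X. X \<in> C}"
    unfolding C'' C' eq[symmetric] by blast
  moreover have "invertible (P ** A)" "invertible (B ** Q)"
    using AB PQ by (auto intro: invertible_mult)
  ultimately show ?thesis
    unfolding code_equivalent_def by blast
qed

lemma equiv_perfect_msrd: "equiv perfect_msrd_codes perfect_msrd_equiv"
proof (rule equivI)
  show "perfect_msrd_equiv \<subseteq> perfect_msrd_codes \<times> perfect_msrd_codes"
    by (auto simp: perfect_msrd_equiv_def)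
  show "refl_on perfect_msrd_codes perfect_msrd_equiv"
    by (auto simp: refl_on_def perfect_msrd_equiv_def code_equivalent_refl)
  show "sym perfect_msrd_equiv"
    by (auto simp: sym_def perfect_msrd_equiv_def intro: code_equivalent_sym)
  show "trans perfect_msrd_equiv"
    by (auto simp: trans_def perfect_msrd_equiv_def intro: code_equivalent_trans)
qed

end

theory Submission
  imports "HOL-Algebra.Algebraic_Closure_Type" Defs
begin

text \<open>
  Let \<open>q = |F|\<close>, let \<open>K\<close> be the cubic extension of \<open>F\<close> and write \<open>x', x''\<close> for the conjugates of
  \<open>x\<close>. Two independent codewords \<open>A, B\<close> form a pencil without singular members, so \<open>B\<inverse> A\<close> has
  three conjugate eigenvectors over \<open>K\<close>. With respect to these, symmetric matrices over \<open>F\<close> become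
  the matrices \<open>H(a, b)\<close> with diagonal \<open>a, a', a''\<close> and off-diagonal entries \<open>b, b', b''\<close>, while
  \<open>A\<close> and \<open>B\<close> become diagonal. If \<open>b = 0\<close> for all codewords, the code is \<open>{H(a, 0)}\<close>, the field
  code. Otherwise rescaling the eigenvectors gives a codeword with \<open>b = 1\<close>, and the diagonal
  codewords are the \<open>H(x, 0)\<close> with \<open>Tr (c x) = 0\<close> for some \<open>c\<close>. Since
  \<open>det H(1 + w, 1) = N(w) (1 + Tr (1 / w))\<close>, nonsingularity says that a certain equation
  \<open>Tr v * Tr (c / v) = m\<close> has no solution \<open>v\<close> in \<open>K\<close>. This equation defines a plane cubic curve,
  and a Stepanov-type argument shows that it is solvable for \<open>q > 2\<close> unless \<open>c = m\<close> lies in \<open>F\<close>. In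
  that case the code is \<open>{H(a, Tr a / 2)}\<close> and \<open>q\<close> is odd. Both codes have the form
  \<open>{H(a, e Tr a)}\<close>, where \<open>det H(a, e Tr a) = N(a) + e\<^sup>2 (2 e - 1) (Tr a)\<^sup>3\<close>, so the classes
  correspond to the roots of \<open>e (2 e - 1)\<close> in \<open>F\<close>. They are distinct because quotients of codewords
  commute only for \<open>e = 0\<close>.
\<close>

no_notation fps_nth (infixl "$" 75)

section \<open>Multiple roots and dual numbers\<close>

lemma two_le_order_iff:
  fixes p :: "'a::idom poly"
  assumes "p \<noteq> 0"
  shows "2 \<le> order a p \<longleftrightarrow> poly p a = 0 \<and> poly (pderiv p) a = 0"
proof (cases "poly p a = 0")
  case True
  then obtain r where r: "p = [:- a, 1:] * r"
    by (auto simp: poly_eq_0_iff_dvd)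
  have "2 \<le> order a p \<longleftrightarrow> [:- a, 1:] * [:- a, 1:] dvd [:- a, 1:] * r"
    using assms order_divides[of a 2 p] unfolding r power2_eq_square by blast
  also have "\<dots> \<longleftrightarrow> poly r a = 0"
    unfolding poly_eq_0_iff_dvd by (subst idom_class.dvd_mult_cancel_left) simp
  also have "poly r a = poly (pderiv p) a"
    unfolding r pderiv_mult by (simp add: pderiv_pCons)
  finally show ?thesis
    using True by simp
next
  case False
  then show ?thesis
    using order_0I by fastforce
qed

lemma size_proots_eq_degree:
  fixes p :: "'a::alg_closed_field poly"
  assumes "p \<noteq> 0"
  shows "size (proots p) = degree p"
proof -
  obtain A where A: "size A = degree p" "p = smult (lead_coeff p) (\<Prod>x\<in>#A. [:- x, 1:])"
    using alg_closed_imp_factorization[OF assms] by blast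
  have "proots (\<Prod>x\<in>#A. [:- x, 1:]) = A"
    by (induction A) (simp_all add: proots_mult prod_mset_zero_iff image_iff del: mult_pCons_left)
  then have "proots p = A"
    using A(2) assms by (metis proots_smult leading_coeff_0_iff)
  then show ?thesis
    using A(1) by simp
qed

lemma card_simple_roots:
  fixes p :: "'a::alg_closed_field poly"
  assumes "p \<noteq> 0" "\<And>a. poly p a = 0 \<Longrightarrow> poly (pderiv p) a \<noteq> 0"
  shows "card {a. poly p a = 0} = degree p"
proof -
  have "order a p = 1" if "poly p a = 0" for a
    using two_le_order_iff[OF assms(1), of a] order_root[of p a] assms that by fastforce
  then have "card {a. poly p a = 0} = (\<Sum>a | poly p a = 0. order a p)"
    by simp
  also have "\<dots> = size (proots p)"
    using assms(1) by (simp add: size_multiset_overloaded_eq)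
  finally show ?thesis
    by (simp add: size_proots_eq_degree assms(1))
qed

lemma card_double_roots_le_degree:
  fixes p :: "'a::idom poly"
  assumes "p \<noteq> 0" "\<And>a. a \<in> S \<Longrightarrow> poly p a = 0 \<and> poly (pderiv p) a = 0"
  shows "2 * card S \<le> degree p"
proof -
  have "2 * card S = (\<Sum>a\<in>S. 2)"
    by simp
  also have "\<dots> \<le> (\<Sum>a\<in>S. order a p)"
    by (intro sum_mono) (simp add: two_le_order_iff assms)
  also have "\<dots> \<le> (\<Sum>a | poly p a = 0. order a p)"
    using assms by (intro sum_mono2 poly_roots_finite) auto
  also have "\<dots> \<le> degree p"
    using assms(1) by (rule sum_order_le_degree)
  finally show ?thesis .
qed

datatype 'a dual = Dual (dual_val: 'a) (dual_eps: 'a)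

instantiation dual :: (comm_ring_1) comm_ring_1
begin

definition zero_dual :: "'a dual" where "0 = Dual 0 0"
definition one_dual :: "'a dual" where "1 = Dual 1 0"
definition plus_dual :: "'a dual \<Rightarrow> 'a dual \<Rightarrow> 'a dual" where
  "u + v = Dual (dual_val u + dual_val v) (dual_eps u + dual_eps v)"
definition minus_dual :: "'a dual \<Rightarrow> 'a dual \<Rightarrow> 'a dual" where
  "u - v = Dual (dual_val u - dual_val v) (dual_eps u - dual_eps v)"
definition uminus_dual :: "'a dual \<Rightarrow> 'a dual" where
  "- u = Dual (- dual_val u) (- dual_eps u)"
definition times_dual :: "'a dual \<Rightarrow> 'a dual \<Rightarrow> 'a dual" where
  "u * v = Dual (dual_val u * dual_val v) (dual_val u * dual_eps v + dual_eps u * dual_val v)"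

instance
  by standard
    (auto simp: zero_dual_def one_dual_def plus_dual_def minus_dual_def uminus_dual_def
       times_dual_def algebra_simps)

end

lemmas dual_defs = zero_dual_def one_dual_def plus_dual_def minus_dual_def uminus_dual_def
  times_dual_def

lemma dual_val_simps [simp]:
  "dual_val 0 = 0" "dual_val 1 = 1" "dual_val (u + v) = dual_val u + dual_val v"
  "dual_val (u - v) = dual_val u - dual_val v" "dual_val (- u) = - dual_val u"
  "dual_val (u * v) = dual_val u * dual_val v"
  by (simp_all add: dual_defs)

lemma dual_val_power [simp]: "dual_val (u ^ n) = dual_val u ^ n"
  by (induction n) simp_all

lemma dual_eps_simps [simp]:
  "dual_eps 0 = 0" "dual_eps 1 = 0" "dual_eps (u + v) = dual_eps u + dual_eps v"
  "dual_eps (u - v) = dual_eps u - dual_eps v" "dual_eps (- u) = - dual_eps u"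
  "dual_eps (u * v) = dual_val u * dual_eps v + dual_eps u * dual_val v"
  by (simp_all add: dual_defs)

lemma dual_eps_power [simp]: "dual_eps (u ^ n) = of_nat n * dual_val u ^ (n - 1) * dual_eps u"
  for u :: "'a::comm_ring_1 dual"
proof (induction n)
  case (Suc n)
  then show ?case
    by (cases n) (simp_all add: algebra_simps)
qed simp

lemma dual_eq_iff: "u = v \<longleftrightarrow> dual_val u = dual_val v \<and> dual_eps u = dual_eps v"
  by (cases u; cases v) simp

lemma dual_mult_eq_0_cancel:
  fixes u v :: "'a::idom dual"
  assumes "u * v = 0" "dual_val u \<noteq> 0"
  shows "v = 0"
  using assms by (auto simp: dual_eq_iff)

lemma dual_quadratic_roots:
  fixes s p :: "'a::field dual"
  assumes "x1 + x2 = dual_val s" "x1 * x2 = dual_val p" "x1 \<noteq> x2"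
  obtains u1 u2 where "u1 + u2 = s" "u1 * u2 = p" "dual_val u1 = x1" "dual_val u2 = x2"
    "(x1 - x2) * dual_eps u1 = x1 * dual_eps s - dual_eps p"
proof
  define t where "t = (x1 * dual_eps s - dual_eps p) / (x1 - x2)"
  show t: "(x1 - x2) * dual_eps (Dual x1 t) = x1 * dual_eps s - dual_eps p"
    using assms(3) by (simp add: t_def)
  show "Dual x1 t + Dual x2 (dual_eps s - t) = s"
    using assms(1) by (simp add: dual_eq_iff)
  show "Dual x1 t * Dual x2 (dual_eps s - t) = p"
    using assms(2) t by (simp add: dual_eq_iff algebra_simps)
qed simp_all

definition jet :: "'a::idom \<Rightarrow> 'a poly \<Rightarrow> 'a dual" where
  "jet y p = Dual (poly p y) (poly (pderiv p) y)"

lemma dual_val_jet [simp]: "dual_val (jet y p) = poly p y"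
  and dual_eps_jet [simp]: "dual_eps (jet y p) = poly (pderiv p) y"
  by (simp_all add: jet_def)

lemma jet_0 [simp]: "jet y 0 = 0"
  and jet_1 [simp]: "jet y 1 = 1"
  and jet_add [simp]: "jet y (p + r) = jet y p + jet y r"
  and jet_diff [simp]: "jet y (p - r) = jet y p - jet y r"
  and jet_minus [simp]: "jet y (- p) = - jet y p"
  and jet_mult [simp]: "jet y (p * r) = jet y p * jet y r"
  by (auto simp: dual_eq_iff pderiv_add pderiv_diff pderiv_minus pderiv_mult algebra_simps)

lemma jet_power [simp]: "jet y (p ^ n) = jet y p ^ n"
  by (induction n) auto

lemma jet_of_nat [simp]: "jet y (of_nat n) = of_nat n"
  by (induction n) auto

lemma jet_numeral [simp]: "jet y (numeral n) = numeral n"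
  using jet_of_nat[of y "numeral n"] by simp

lemma jet_eq_0_iff: "jet y p = 0 \<longleftrightarrow> poly p y = 0 \<and> poly (pderiv p) y = 0"
  by (simp add: dual_eq_iff)

section \<open>The tangency polynomial\<close>

fun lucas_diff :: "'a::comm_ring_1 \<Rightarrow> 'a \<Rightarrow> nat \<Rightarrow> 'a" where
  "lucas_diff M P 0 = 0"
| "lucas_diff M P (Suc 0) = M\<^sup>2 - 4 * P"
| "lucas_diff M P (Suc (Suc n)) = - M * lucas_diff M P (Suc n) - P * lucas_diff M P n"

lemma lucas_diff_eq:
  assumes "X1 + X2 = - M" "X1 * X2 = P"
  shows "lucas_diff M P n = (X1 - X2) * (X1 ^ n - X2 ^ n)"
proof -
  have M: "M = - (X1 + X2)"
    using assms(1) by simp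
  show ?thesis
    unfolding M assms(2)[symmetric]
  proof (induction n rule: induct_nat_012)
    case (ge2 n)
    show ?case
      unfolding lucas_diff.simps ge2 by (simp add: algebra_simps)
  qed (simp_all add: power2_eq_square algebra_simps)
qed

lemma jet_lucas_diff [simp]: "jet y (lucas_diff M P n) = lucas_diff (jet y M) (jet y P) n"
  by (induction M P n rule: lucas_diff.induct) simp_all

lemma poly_lucas_diff [simp]: "poly (lucas_diff M P n) y = lucas_diff (poly M y) (poly P y) n"
  by (induction M P n rule: lucas_diff.induct) simp_all

lemma degree_mult_leI: "degree p \<le> m \<Longrightarrow> degree r \<le> n \<Longrightarrow> m + n \<le> k \<Longrightarrow> degree (p * r) \<le> k"
  using degree_mult_le[of p r] by linarith

lemma degree_power_leI: "degree p \<le> m \<Longrightarrow> m * n \<le> k \<Longrightarrow> degree (p ^ n) \<le> k"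
  using degree_power_le[of p n] mult_le_mono1[of "degree p" m n] by linarith

lemma degree_lucas_diff_le:
  assumes "degree M \<le> d" "degree P \<le> 2 * d"
  shows "degree (lucas_diff M P n) \<le> d * Suc n"
  using assms
proof (induction M P n rule: lucas_diff.induct)
  case (2 M P)
  have "degree (M\<^sup>2) \<le> d * 2" "degree (4 * P) \<le> d * 2"
    using 2 by (auto intro: degree_power_leI degree_mult_leI[where m = 0])
  then show ?case
    by (simp add: degree_diff_le)
next
  case (3 M P n)
  have "degree (M * lucas_diff M P (Suc n)) \<le> d * Suc (Suc (Suc n))"
    by (rule degree_mult_leI[OF 3(3) 3(1)[OF 3(3,4)]]) simp
  moreover have "degree (P * lucas_diff M P n) \<le> d * Suc (Suc (Suc n))"
    by (rule degree_mult_leI[OF 3(4) 3(2)[OF 3(3,4)]]) simp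
  ultimately show ?case
    by (simp add: degree_diff_le)
qed simp

text \<open>
  Let \<open>x\<^sub>1, x\<^sub>2\<close> be the roots of \<open>f = L x\<^sup>2 + M x + N\<close>, let \<open>Y\<close> stand for \<open>y\<^sup>q\<close> and the primes for
  derivatives with respect to \<open>y\<close>. Evaluate the linear form that defines the tangent of \<open>f = 0\<close> at
  \<open>(x\<^sub>i, y)\<close> at the point \<open>(1 / Y, x\<^sub>j\<^sup>q / Y)\<close>, \<open>j \<noteq> i\<close>. The product of the two values, times
  \<open>L\<^bsup>q + 2\<^esup> Y\<^sup>2\<close>, is the following expression; see \<open>tangent_norm_factorization\<close>, where
  \<open>X\<^sub>i = L x\<^sub>i\<close>.
\<close>

definition tangent_norm :: "nat \<Rightarrow> 'a::comm_ring_1 \<Rightarrow> 'a \<Rightarrow> 'a \<Rightarrow> 'a \<Rightarrow> 'a \<Rightarrow> 'a \<Rightarrow> 'a \<Rightarrow> 'a \<Rightarrow> 'a" where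
  "tangent_norm q y Y L M N L' M' N' =
    (let a = L * M' - L' * M; b = L * N' - L' * N; h = L + M * Y + N * Y\<^sup>2 in
      (a * (M' * N - N' * M) + b\<^sup>2) * (Y * h)
      - lucas_diff M (L * N) 1 * L ^ q * (L * h - y * Y * (a + b * Y))
      + (L * b - a * Y * N + b * M * Y) * lucas_diff M (L * N) q
      + (a + b * Y) * (L * N * lucas_diff M (L * N) (q - 1)))"

lemma jet_tangent_norm:
  "jet z (tangent_norm q y Y L M N L' M' N') =
    tangent_norm q (jet z y) (jet z Y) (jet z L) (jet z M) (jet z N)
      (jet z L') (jet z M') (jet z N')"
  by (simp add: tangent_norm_def Let_def)

lemma poly_tangent_norm:
  "poly (tangent_norm q y Y L M N L' M' N') z =
    tangent_norm q (poly y z) (poly Y z) (poly L z) (poly M z) (poly N z)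
      (poly L' z) (poly M' z) (poly N' z)"
  by (simp add: tangent_norm_def Let_def)

lemma quadratic_conjugates_product:
  fixes X1 X2 :: "'a::comm_ring_1"
  assumes "X1 + X2 = - M" "X1 * X2 = P"
  shows "(r - X1 * s) * (r - X2 * s) = r\<^sup>2 + M * r * s + P * s\<^sup>2"
proof -
  have "(r - X1 * s) * (r - X2 * s) = r\<^sup>2 - (X1 + X2) * r * s + X1 * X2 * s\<^sup>2"
    by (simp add: algebra_simps power2_eq_square)
  then show ?thesis
    by (simp add: assms)
qed

lemma tangent_norm_cross_term:
  fixes X1 X2 :: "'a::comm_ring_1"
  assumes "X1 + X2 = - M" "X1 * X2 = L * N"
  shows "(X1 - X2) *
      ((L - X1 * Y) * (a * X2 + L * b) * (A1 - w) - (L - X2 * Y) * (a * X1 + L * b) * (A2 - w)) =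
    L * ((L * b - a * Y * N + b * M * Y) * ((X1 - X2) * (A1 - A2))
      + (a + b * Y) * ((X1 - X2) * (X2 * A1 - X1 * A2)) + (X1 - X2)\<^sup>2 * w * (a + b * Y))"
proof -
  have M: "M = - (X1 + X2)"
    using assms(1) by simp
  have swap: "(L - U * Y) * (a * V + L * b) = L * (a * V + L * b - a * Y * N - b * Y * U)"
    if "U * V = L * N" for U V
  proof -
    have "(L - U * Y) * (a * V + L * b) = L * (a * V + L * b - b * Y * U) - a * Y * (U * V)"
      by (simp add: algebra_simps)
    then show ?thesis
      by (simp add: that algebra_simps)
  qed
  have X21: "X2 * X1 = L * N"
    using assms(2) by (simp add: mult.commute)
  show ?thesis
    unfolding swap[OF assms(2)] swap[OF X21] M
    by (simp add: algebra_simps power2_eq_square)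
qed

lemma tangent_norm_factorization:
  fixes L M N L' M' N' y Y X1 X2 :: "'a::comm_ring_1"
  assumes X: "X1 + X2 = - M" "X1 * X2 = L * N"
    and Xq: "X1 ^ q + X2 ^ q = - (M ^ q)" and q: "0 < q"
    and frob: "Y * (L + M * Y + N * Y\<^sup>2) = N ^ q + M ^ q * (y * Y) + L ^ q * (y * Y)\<^sup>2"
  defines "a \<equiv> L * M' - L' * M" and "b \<equiv> L * N' - L' * N"
  shows "L\<^sup>2 * L ^ q * tangent_norm q y Y L M N L' M' N' =
      ((X1 - X2) * L ^ q * L * (L - X1 * Y) + (a * X1 + L * b) * (X2 ^ q - y * Y * L ^ q)) *
      ((X2 - X1) * L ^ q * L * (L - X2 * Y) + (a * X2 + L * b) * (X1 ^ q - y * Y * L ^ q))"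
    (is "_ = (?f1 * ?u1 + ?g1 * ?w2) * (?f2 * ?u2 + ?g2 * ?w1)")
proof -
  define h where "h = L + M * Y + N * Y\<^sup>2"
  define r where "r = a * (M' * N - N' * M) + b\<^sup>2"
  have line_product: "?u1 * ?u2 = L * h"
    unfolding quadratic_conjugates_product[OF X] h_def by (simp add: algebra_simps power2_eq_square)
  have "X1 ^ q * X2 ^ q = L ^ q * N ^ q"
    by (metis X(2) power_mult_distrib)
  from quadratic_conjugates_product[OF Xq this, of "y * Y * L ^ q" 1]
  have "?w1 * ?w2 = L ^ q * (N ^ q + M ^ q * (y * Y) + L ^ q * (y * Y)\<^sup>2)"
    by (simp add: algebra_simps power2_eq_square)
  then have power_product: "?w1 * ?w2 = L ^ q * (Y * h)"
    unfolding h_def frob .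
  from quadratic_conjugates_product[OF X, of "L * b" "- a"]
  have "?g1 * ?g2 = L * (L * b\<^sup>2 + a * (a * N - b * M))"
    by (simp add: algebra_simps power2_eq_square)
  also have "a * N - b * M = L * (M' * N - N' * M)"
    by (simp add: a_def b_def algebra_simps)
  finally have slope_product: "?g1 * ?g2 = L\<^sup>2 * r"
    by (simp add: r_def algebra_simps power2_eq_square)
  have lucas_pred: "L * N * lucas_diff M (L * N) (q - 1) = (X1 - X2) * (X2 * X1 ^ q - X1 * X2 ^ q)"
    unfolding lucas_diff_eq[OF X] unfolding X(2)[symmetric]
    using q by (cases q) (simp_all add: algebra_simps)
  have "(?f1 * ?u1 + ?g1 * ?w2) * (?f2 * ?u2 + ?g2 * ?w1) =
      ?f1 * ?f2 * (?u1 * ?u2) + (?g1 * ?g2) * (?w1 * ?w2)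
      + L ^ q * L * ((X1 - X2) * (?u1 * ?g2 * ?w1 - ?u2 * ?g1 * ?w2))"
    by (simp add: algebra_simps)
  also have "\<dots> = L\<^sup>2 * L ^ q * tangent_norm q y Y L M N L' M' N'"
    unfolding line_product power_product slope_product tangent_norm_cross_term[OF X]
      tangent_norm_def Let_def lucas_pred
    unfolding lucas_diff_eq[OF X] a_def[symmetric] b_def[symmetric] h_def[symmetric]
      r_def[symmetric]
    by (simp add: algebra_simps power2_eq_square)
  finally show ?thesis ..
qed

section \<open>Frobenius orbits on a plane cubic curve\<close>

text \<open>
  Suppose that no orbit \<open>(v, v\<^sup>q, v\<^bsup>q\<^sup>2\<^esup>)\<close> lies on the cubic, that is, that the map
  \<open>\<phi>(x, y, z) = (z\<^sup>q, x\<^sup>q, y\<^sup>q)\<close> of the curve to itself has no fixed point. In the chart \<open>z = 1\<close> the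
  equation is quadratic in \<open>x\<close>; let \<open>\<theta>\<close> exchange the two points with the same \<open>y\<close>. The \<open>2 q + 2\<close>
  roots of \<open>coincidence_poly\<close> belong to the points \<open>P\<close> with \<open>\<phi>(P) = \<theta>(P)\<close>; they are simple, because
  at a double root \<open>\<theta>(P) = P\<close>. The linear form of the tangent at \<open>\<theta>(P)\<close>, evaluated at \<open>\<phi>(P)\<close>,
  vanishes there to second order, since \<open>\<phi>\<close> has derivative \<open>0\<close>. Hence its norm \<open>tangency_poly\<close> has
  \<open>2 q + 2\<close> double roots, but the degree of this polynomial is at most \<open>3 q + 6 < 4 q + 4\<close>.
\<close>

definition conj_cubic :: "'a::comm_ring_1 \<Rightarrow> 'a \<Rightarrow> 'a \<Rightarrow> 'a \<Rightarrow> 'a \<Rightarrow> 'a \<Rightarrow> 'a \<Rightarrow> 'a" where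
  "conj_cubic c1 c2 c3 m x y z =
    (x + y + z) * (c1 * y * z + c2 * z * x + c3 * x * y) - m * x * y * z"

lemma conj_cubic_homogeneous:
  "conj_cubic c1 c2 c3 m (r * x) (r * y) (r * z) = r ^ 3 * conj_cubic c1 c2 c3 m x y z"
  by (simp add: conj_cubic_def power3_eq_cube algebra_simps)

lemma quadratic_vieta:
  fixes l k n :: "'a::field"
  assumes "l * x1\<^sup>2 + k * x1 + n = 0" "l * x2\<^sup>2 + k * x2 + n = 0" "x1 \<noteq> x2"
  shows "l * x1 + l * x2 = - k" "l * x1 * (l * x2) = l * n"
proof -
  have "(x1 - x2) * (l * x1 + l * x2 + k) = (l * x1\<^sup>2 + k * x1 + n) - (l * x2\<^sup>2 + k * x2 + n)"
    by (simp add: algebra_simps power2_eq_square)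
  then have sum: "l * x1 + l * x2 + k = 0"
    using assms by simp
  then show "l * x1 + l * x2 = - k"
    by (simp only: eq_neg_iff_add_eq_0)
  have "l * (x1 * x2) - n = x1 * (l * x1 + l * x2 + k) - (l * x1\<^sup>2 + k * x1 + n)"
    by (simp add: algebra_simps power2_eq_square)
  then have "l * (x1 * x2) = n"
    using assms(1) sum by simp
  then show "l * x1 * (l * x2) = l * n"
    by (simp add: mult_ac)
qed

locale conjugate_cubic =
  fixes q :: nat and c1 c2 c3 m :: "'k::alg_closed_field"
  assumes power_q_add: "(x + y :: 'k) ^ q = x ^ q + y ^ q"
    and of_nat_q: "of_nat q = (0 :: 'k)"
    and q_gt_2: "2 < q"
    and conjugates: "c1 ^ q = c2" "c2 ^ q = c3" "c3 ^ q = c1"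
    and c1_nonzero: "c1 \<noteq> 0"
    and power_q_m: "m ^ q = m"
begin

abbreviation cubic :: "'k \<Rightarrow> 'k \<Rightarrow> 'k \<Rightarrow> 'k" where
  "cubic \<equiv> conj_cubic c1 c2 c3 m"

lemma power_q_diff: "(x - y :: 'k) ^ q = x ^ q - y ^ q"
  using power_q_add[of "x - y" y] by (simp add: algebra_simps)

lemma power_q_minus: "(- x :: 'k) ^ q = - (x ^ q)"
  using power_q_diff[of 0 x] q_gt_2 by simp

lemma power_q_eq_iff: "x ^ q = y ^ q \<longleftrightarrow> x = y" for x y :: 'k
  using power_q_diff[of x y] q_gt_2 by auto

lemma conjugates_nonzero: "c2 \<noteq> 0" "c3 \<noteq> 0"
  using conjugates c1_nonzero q_gt_2 by auto

lemma cubic_power: "cubic x y z ^ q = cubic (z ^ q) (x ^ q) (y ^ q)"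
  by (simp add: conj_cubic_def power_q_diff power_q_add power_mult_distrib conjugates power_q_m
      algebra_simps)

definition mid_coeff :: 'k where "mid_coeff = c1 + c2 + c3 - m"

definition quad_coeff :: "'k poly" where "quad_coeff = [:c2, c3:]"
definition lin_coeff :: "'k poly" where "lin_coeff = [:c2, mid_coeff, c3:]"
definition const_coeff :: "'k poly" where "const_coeff = [:0, c1, c1:]"

lemmas coeff_defs = quad_coeff_def lin_coeff_def const_coeff_def

lemma poly_coeffs:
  "poly quad_coeff y = c2 + c3 * y"
  "poly lin_coeff y = c2 + mid_coeff * y + c3 * y\<^sup>2"
  "poly const_coeff y = c1 * y + c1 * y\<^sup>2"
  by (simp_all add: coeff_defs algebra_simps power2_eq_square)

lemma pderiv_coeffs:
  "pderiv quad_coeff = [:c3:]" "pderiv lin_coeff = [:mid_coeff, 2 * c3:]"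
  "pderiv const_coeff = [:c1, 2 * c1:]"
  by (simp_all add: coeff_defs pderiv_pCons)

lemma poly_coeffs_power:
  "poly quad_coeff y ^ q = c3 + c1 * y ^ q"
  "poly lin_coeff y ^ q = c3 + mid_coeff * y ^ q + c1 * (y ^ q)\<^sup>2"
  "poly const_coeff y ^ q = c2 * y ^ q + c2 * (y ^ q)\<^sup>2"
proof -
  have "mid_coeff ^ q = mid_coeff"
    by (simp add: mid_coeff_def power_q_add power_q_diff conjugates power_q_m)
  then show "poly quad_coeff y ^ q = c3 + c1 * y ^ q"
    "poly lin_coeff y ^ q = c3 + mid_coeff * y ^ q + c1 * (y ^ q)\<^sup>2"
    "poly const_coeff y ^ q = c2 * y ^ q + c2 * (y ^ q)\<^sup>2"
    by (simp_all add: poly_coeffs power_q_add power_mult_distrib conjugates power2_eq_square)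
qed

lemma cubic_affine:
  "cubic x y 1 = poly quad_coeff y * x\<^sup>2 + poly lin_coeff y * x + poly const_coeff y"
  by (simp add: conj_cubic_def poly_coeffs mid_coeff_def algebra_simps power2_eq_square)

definition coincidence_poly :: "'k poly" where
  "coincidence_poly = quad_coeff + lin_coeff * monom 1 q + const_coeff * (monom 1 q)\<^sup>2"

lemma poly_coincidence_poly:
  "poly coincidence_poly y =
    poly quad_coeff y + poly lin_coeff y * y ^ q + poly const_coeff y * (y ^ q)\<^sup>2"
  by (simp add: coincidence_poly_def poly_monom)

lemma coincidence_root_nonzero: "poly coincidence_poly y = 0 \<Longrightarrow> y \<noteq> 0"
  using conjugates_nonzero q_gt_2 by (auto simp: poly_coincidence_poly poly_coeffs power_0_left)

lemma coincidence_root_first_point: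
  assumes "poly coincidence_poly y = 0"
  shows "cubic (1 / y ^ q) y 1 = 0"
proof -
  have "cubic (1 / y ^ q) y 1 = poly coincidence_poly y / (y ^ q)\<^sup>2"
    using coincidence_root_nonzero[OF assms]
    by (simp add: cubic_affine poly_coincidence_poly field_simps power2_eq_square)
  then show ?thesis
    by (simp add: assms)
qed

lemma coincidence_root_second_point:
  assumes "poly coincidence_poly y = 0" "x ^ q = y * y ^ q"
  shows "cubic x y 1 = 0"
proof -
  have y: "y \<noteq> 0"
    using assms(1) by (rule coincidence_root_nonzero)
  have "cubic x y 1 ^ q = cubic 1 (y * y ^ q) (y ^ q)"
    by (simp add: cubic_power assms(2))
  also have "\<dots> = (y ^ q) ^ 3 * cubic (1 / y ^ q) y 1"
    using y by (simp add: mult.commute flip: conj_cubic_homogeneous)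
  also have "\<dots> = 0"
    by (simp add: coincidence_root_first_point[OF assms(1)])
  finally show ?thesis
    by simp
qed

lemma orbit_zero_if_points_coincide:
  assumes root: "poly coincidence_poly y = 0" and coincide: "(1 / y ^ q) ^ q = y * y ^ q"
  shows "\<exists>v. v \<noteq> 0 \<and> v ^ q ^ 3 = v \<and> cubic v (v ^ q) (v ^ q\<^sup>2) = 0"
proof -
  have y: "y \<noteq> 0"
    using root by (rule coincidence_root_nonzero)
  obtain r where r: "r ^ (q - 1) = 1 / y ^ q"
    using nth_root_exists[of "q - 1" "1 / y ^ q"] q_gt_2 by auto
  have r0: "r \<noteq> 0"
    using r y q_gt_2 by (auto simp: power_0_left)
  have rq: "r ^ q = r * (1 / y ^ q)"
    using r q_gt_2 by (cases q) simp_all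
  define v where "v = r * (1 / y ^ q)"
  have v1: "v ^ q = r * y"
    unfolding v_def power_mult_distrib coincide rq using y by simp
  have "v ^ q\<^sup>2 = (r * y) ^ q"
    by (simp add: power2_eq_square power_mult v1)
  also have "\<dots> = r"
    using y by (simp add: power_mult_distrib rq)
  finally have v2: "v ^ q\<^sup>2 = r" .
  have "v ^ q ^ 3 = v"
    using v2 rq by (simp add: power3_eq_cube power2_eq_square power_mult v_def)
  moreover have "cubic v (v ^ q) (v ^ q\<^sup>2) = r ^ 3 * cubic (1 / y ^ q) y 1"
    unfolding v1 v2 unfolding v_def conj_cubic_homogeneous[symmetric] by simp
  ultimately show ?thesis
    using r0 y coincidence_root_first_point[OF root] by (intro exI[of _ v]) (simp add: v_def)
qed

lemma quad_coeff_nonzero: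
  assumes points: "cubic x1 y 1 = 0" "cubic x2 y 1 = 0" "x1 \<noteq> x2" and "y \<noteq> 0"
    and general: "\<not> (c1 = c2 \<and> m = c1)"
  shows "poly quad_coeff y \<noteq> 0"
proof
  assume quad: "poly quad_coeff y = 0"
  have lin: "poly lin_coeff y = 0"
    using quadratic_vieta(1)[OF points[unfolded cubic_affine]] quad by simp
  then have const: "poly const_coeff y = 0"
    using points(1) quad by (simp add: cubic_affine)
  then have "c1 * (y * (1 + y)) = 0"
    by (simp add: poly_coeffs power2_eq_square algebra_simps)
  then have y: "y = - 1"
    using \<open>y \<noteq> 0\<close> c1_nonzero by (simp add: add_eq_0_iff)
  have "c2 = c3"
    using quad y by (simp add: poly_coeffs)
  then have "c1 = c2"
    using conjugates by (metis power_q_eq_iff)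
  moreover have "m = c1"
    using lin \<open>c2 = c3\<close> unfolding poly_coeffs mid_coeff_def y by simp
  ultimately show False
    using general by simp
qed

definition tangency_poly :: "'k poly" where
  "tangency_poly = tangent_norm q [:0, 1:] (monom 1 q) quad_coeff lin_coeff const_coeff
     (pderiv quad_coeff) (pderiv lin_coeff) (pderiv const_coeff)"

lemma jet_monom_q: "jet y (monom 1 q) = Dual (y ^ q) 0" for y :: 'k
  by (simp add: jet_def poly_monom pderiv_monom of_nat_q)

lemma dual_power_q: "u ^ q = Dual (dual_val u ^ q) 0" for u :: "'k dual"
  by (simp add: dual_eq_iff of_nat_q)

lemma jet_coincidence_power:
  "jet y (monom 1 q) * jet y coincidence_poly = jet y const_coeff ^ q
    + jet y lin_coeff ^ q * (jet y [:0, 1:] * jet y (monom 1 q))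
    + jet y quad_coeff ^ q * (jet y [:0, 1:] * jet y (monom 1 q))\<^sup>2"
  by (simp add: coincidence_poly_def jet_monom_q dual_power_q poly_coeffs_power)
    (simp add: dual_eq_iff poly_coeffs pderiv_coeffs pderiv_pCons algebra_simps power2_eq_square)

end

lemma tangent_derivative_identity:
  fixes X1 X2 t z :: "'a::comm_ring_1"
  assumes "X1 + X2 = - M" "X1 * z = L" "X2 = N * z"
    and t: "(X1 - X2) * t = - (M' * X1) - (L' * N + L * N')"
  shows "(X1 - X2) * (L' - t * z) * L =
    ((L * M' - L' * M) * X1 + L * (L * N' - L' * N)) * z"
proof -
  have M: "M = - (X1 + X2)"
    using assms(1) by simp
  have "(X1 - X2) * (L' - t * z) * L = ((X1 - X2) * L' - (X1 - X2) * t * z) * L"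
    by (simp add: algebra_simps)
  also have "\<dots> = ((X1 - X2) * L' + (M' * X1 + L' * N + L * N') * z) * L"
    unfolding t by (simp add: algebra_simps)
  also have "\<dots> = ((L * M' - L' * M) * X1 + L * (L * N' - L' * N)) * z"
    unfolding M assms(3) assms(2)[symmetric] by (simp add: algebra_simps)
  finally show ?thesis .
qed

locale coincidence_root = conjugate_cubic q c1 c2 c3 m
  for q and c1 c2 c3 m :: "'k::alg_closed_field" +
  fixes y x1 x2 :: 'k
  assumes root: "poly coincidence_poly y = 0"
    and x1: "x1 = 1 / y ^ q" and x2: "x2 ^ q = y * y ^ q" and distinct: "x1 \<noteq> x2"
    and general: "\<not> (c1 = c2 \<and> m = c1)"
begin

lemma points:
  "poly quad_coeff y * x1\<^sup>2 + poly lin_coeff y * x1 + poly const_coeff y = 0"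
  "poly quad_coeff y * x2\<^sup>2 + poly lin_coeff y * x2 + poly const_coeff y = 0"
  using coincidence_root_first_point[OF root] coincidence_root_second_point[OF root x2]
  by (simp_all add: cubic_affine x1)

lemmas vieta = quadratic_vieta[OF points distinct]

lemma quad_coeff_at_root: "poly quad_coeff y \<noteq> 0"
  by (rule quad_coeff_nonzero[OF _ _ distinct coincidence_root_nonzero[OF root] general])
    (simp_all add: cubic_affine points)

lemma root_simple: "poly (pderiv coincidence_poly) y \<noteq> 0"
proof -
  have "poly (pderiv coincidence_poly) y
      = c3 + (mid_coeff + 2 * c3 * y) * y ^ q + (c1 + 2 * c1 * y) * (y ^ q)\<^sup>2"
    by (simp add: coincidence_poly_def pderiv_add pderiv_mult pderiv_monom pderiv_coeffs poly_monom
        of_nat_q power2_eq_square algebra_simps)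
  also have "\<dots> = poly lin_coeff y ^ q + 2 * poly quad_coeff y ^ q * (y * y ^ q)"
    by (simp add: poly_coeffs_power power2_eq_square algebra_simps)
  also have "\<dots> = (poly lin_coeff y + 2 * poly quad_coeff y * x2) ^ q"
    using power_q_add[of 1 1] by (simp add: power_q_add power_mult_distrib x2)
  also have "poly lin_coeff y = - (poly quad_coeff y * x1 + poly quad_coeff y * x2)"
    by (simp add: vieta(1))
  also have "\<dots> + 2 * poly quad_coeff y * x2 = poly quad_coeff y * (x2 - x1)"
    by (simp add: algebra_simps)
  finally show ?thesis
    using quad_coeff_at_root distinct by simp
qed

lemma tangent_form_vanishes:
  fixes U1 U2 :: "'k dual"
  defines "l \<equiv> poly quad_coeff y" and "L \<equiv> jet y quad_coeff" and "M \<equiv> jet y lin_coeff"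
    and "N \<equiv> jet y const_coeff" and "Y \<equiv> jet y (monom 1 q)" and "L' \<equiv> jet y (pderiv quad_coeff)"
    and "M' \<equiv> jet y (pderiv lin_coeff)" and "N' \<equiv> jet y (pderiv const_coeff)"
  assumes val: "dual_val U1 = l * x1" "dual_val U2 = l * x2"
    and eps: "(l * x1 - l * x2) * dual_eps U1 = l * x1 * dual_eps (- M) - dual_eps (L * N)"
  shows "(U1 - U2) * L ^ q * L * (L - U1 * Y)
    + ((L * M' - L' * M) * U1 + L * (L * N' - L' * N)) * (U2 ^ q - jet y [:0, 1:] * Y * L ^ q) = 0"
proof -
  note jets = L_def M_def N_def Y_def L'_def M'_def N'_def l_def
  define z where "z = y ^ q"
  define T where "T = (L * M' - L' * M) * U1 + L * (L * N' - L' * N)"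
  have "z \<noteq> 0"
    using coincidence_root_nonzero[OF root] by (simp add: z_def)
  then have X1: "l * x1 * z = l"
    by (simp add: x1 z_def)
  then have X2: "l * x2 = poly const_coeff y * z"
    using vieta(2) quad_coeff_at_root unfolding l_def[symmetric]
    by (metis mult.assoc mult.commute mult_cancel_left)
  have "(l * x1 - l * x2) * (dual_eps L - dual_eps U1 * z) * l = dual_val T * z"
    using tangent_derivative_identity[OF vieta(1), folded l_def, OF X1 X2] eps
    by (simp add: T_def val jets)
  then have cancel: "(l * x1 - l * x2) * l ^ q * l * (dual_eps L - dual_eps U1 * z)
      = dual_val T * (z * l ^ q)"
    by (metis mult.assoc mult.commute)
  have chord: "L - U1 * Y = Dual 0 (dual_eps L - dual_eps U1 * z)"
    using X1 by (simp add: dual_eq_iff val jets jet_monom_q z_def)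
  have image: "U2 ^ q - jet y [:0, 1:] * Y * L ^ q = Dual 0 (- (z * l ^ q))"
    by (simp add: dual_eq_iff dual_power_q val jets jet_monom_q power_mult_distrib x2 z_def
        pderiv_pCons)
  show ?thesis
    unfolding chord image T_def[symmetric] using cancel
    by (simp add: dual_eq_iff val) (simp add: jets)
qed

lemma tangency_double_root: "jet y tangency_poly = 0"
proof -
  let ?l = "poly quad_coeff y" and ?L = "jet y quad_coeff" and ?M = "jet y lin_coeff"
    and ?N = "jet y const_coeff" and ?y = "jet y [:0, 1:]" and ?Y = "jet y (monom 1 q)"
  obtain U1 U2 where U: "U1 + U2 = - ?M" "U1 * U2 = ?L * ?N"
    and val: "dual_val U1 = ?l * x1" "dual_val U2 = ?l * x2"
    and eps: "(?l * x1 - ?l * x2) * dual_eps U1 = ?l * x1 * dual_eps (- ?M) - dual_eps (?L * ?N)"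
    using dual_quadratic_roots[of "?l * x1" "?l * x2" "- ?M" "?L * ?N"] vieta quad_coeff_at_root
      distinct by auto
  have Uq: "U1 ^ q + U2 ^ q = - (?M ^ q)"
    using vieta(1) by (simp add: dual_power_q val dual_eq_iff flip: power_q_add power_q_minus)
  have image: "?Y * (?L + ?M * ?Y + ?N * ?Y\<^sup>2) = ?N ^ q + ?M ^ q * (?y * ?Y) + ?L ^ q * (?y * ?Y)\<^sup>2"
    using jet_coincidence_power[of y] by (simp add: coincidence_poly_def)
  have "?L\<^sup>2 * ?L ^ q * jet y tangency_poly = 0"
    unfolding tangency_poly_def jet_tangent_norm
    using tangent_norm_factorization[OF U Uq _ image] tangent_form_vanishes[OF val eps] q_gt_2
    by simp
  then show ?thesis
    by (rule dual_mult_eq_0_cancel) (use quad_coeff_at_root in simp)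
qed

end

lemma degree_tangent_norm_le:
  fixes L M N L' M' N' y Y :: "'a::idom poly"
  defines "a \<equiv> L * M' - L' * M" and "b \<equiv> L * N' - L' * N"
  assumes L: "degree L \<le> 1" and M: "degree M \<le> 2" and N: "degree N \<le> 2"
    and a: "degree a \<le> 2" and b: "degree b \<le> 2" and r: "degree (M' * N - N' * M) \<le> 2"
    and LM: "degree (L * M - y * a) \<le> 2" and LN: "degree (L * N - y * b) \<le> 2"
    and Y: "degree Y \<le> q" and "0 < q"
  shows "degree (tangent_norm q y Y L M N L' M' N') \<le> 3 * q + 6"
proof -
  define h where "h = L + M * Y + N * Y\<^sup>2"
  have Y2: "degree (Y\<^sup>2) \<le> 2 * q"
    using degree_power_leI[OF Y, of 2] by simp
  have h: "degree h \<le> 2 * q + 2"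
    unfolding h_def
    by (intro degree_add_le order_trans[OF L] degree_mult_leI[OF M Y] degree_mult_leI[OF N Y2])
      simp_all
  have product: "degree (L * N) \<le> 3"
    by (rule degree_mult_leI[OF L N]) simp
  have lucas: "degree (lucas_diff M (L * N) n) \<le> 2 * Suc n" for n
    using M product by (intro degree_lucas_diff_le) simp_all
  have chord: "degree (a + b * Y) \<le> q + 2"
    by (intro degree_add_le degree_mult_leI[OF b Y] order_trans[OF a]) simp_all
  have "L * h - y * Y * (a + b * Y) = L\<^sup>2 + (L * M - y * a) * Y + (L * N - y * b) * Y\<^sup>2"
    by (simp add: h_def algebra_simps power2_eq_square)
  also have "degree \<dots> \<le> 2 * q + 2"
    by (intro degree_add_le degree_power_leI[OF L] degree_mult_leI[OF LM Y]
        degree_mult_leI[OF LN Y2]) simp_all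
  finally have tangent: "degree (L * h - y * Y * (a + b * Y)) \<le> 2 * q + 2" .
  have "degree ((a * (M' * N - N' * M) + b\<^sup>2) * (Y * h)) \<le> 3 * q + 6"
    by (intro degree_mult_leI[where m = 4 and n = "3 * q + 2"] degree_add_le degree_mult_leI[OF a r]
        degree_power_leI[OF b] degree_mult_leI[OF Y h]) simp_all
  moreover have
    "degree (lucas_diff M (L * N) 1 * L ^ q * (L * h - y * Y * (a + b * Y))) \<le> 3 * q + 6"
    by (intro degree_mult_leI[OF _ tangent, where m = "4 + q"]
        degree_mult_leI[OF lucas degree_power_leI[OF L order_refl]]) simp_all
  moreover have "degree ((L * b - a * Y * N + b * M * Y) * lucas_diff M (L * N) q) \<le> 3 * q + 6"
    by (intro degree_mult_leI[OF _ lucas, where m = "q + 4"] degree_add_le degree_diff_le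
        degree_mult_leI[OF L b] degree_mult_leI[OF degree_mult_leI[OF a Y order_refl] N]
        degree_mult_leI[OF degree_mult_leI[OF b M order_refl] Y]) simp_all
  moreover have "degree ((a + b * Y) * (L * N * lucas_diff M (L * N) (q - 1))) \<le> 3 * q + 6"
    using \<open>0 < q\<close>
    by (intro degree_mult_leI[OF chord degree_mult_leI[OF product lucas order_refl]]) simp_all
  ultimately show ?thesis
    unfolding tangent_norm_def Let_def a_def[symmetric] b_def[symmetric] h_def[symmetric]
    by (intro degree_add_le degree_diff_le)
qed

context conjugate_cubic
begin

lemma degree_coincidence_poly: "degree coincidence_poly = 2 * q + 2"
proof -
  have "const_coeff \<noteq> 0" "degree const_coeff = 2"
    using c1_nonzero by (simp_all add: const_coeff_def)
  then have "degree (const_coeff * (monom 1 q)\<^sup>2) = 2 * q + 2"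
    by (simp add: degree_mult_eq degree_power_eq degree_monom_eq monom_eq_0_iff)
  moreover have "degree (quad_coeff + lin_coeff * monom 1 q) \<le> q + 2"
    by (intro degree_add_le degree_mult_leI[of _ 2 _ q]) (simp_all add: coeff_defs degree_monom_eq)
  ultimately show ?thesis
    unfolding coincidence_poly_def using q_gt_2 by (subst degree_add_eq_right) auto
qed

lemma degree_wronskians:
  defines "a \<equiv> quad_coeff * pderiv lin_coeff - pderiv quad_coeff * lin_coeff"
    and "b \<equiv> quad_coeff * pderiv const_coeff - pderiv quad_coeff * const_coeff"
  shows "degree a \<le> 2" "degree b \<le> 2"
    "degree (pderiv lin_coeff * const_coeff - pderiv const_coeff * lin_coeff) \<le> 2"
    "degree (quad_coeff * lin_coeff - [:0, 1:] * a) \<le> 2"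
    "degree (quad_coeff * const_coeff - [:0, 1:] * b) \<le> 2"
proof -
  have a: "a = [:c2 * mid_coeff - c2 * c3, 2 * c2 * c3, c3\<^sup>2:]"
    and b: "b = [:c1 * c2, 2 * c1 * c2, c1 * c3:]"
    unfolding a_def b_def pderiv_coeffs
    by (simp_all add: coeff_defs algebra_simps power2_eq_square)
  show "degree a \<le> 2" "degree b \<le> 2"
    by (simp_all add: a b)
  have "pderiv lin_coeff * const_coeff - pderiv const_coeff * lin_coeff =
      [:- c1 * c2, - 2 * c1 * c2, c1 * (c3 - mid_coeff):]"
    unfolding pderiv_coeffs by (simp add: coeff_defs algebra_simps)
  then show "degree (pderiv lin_coeff * const_coeff - pderiv const_coeff * lin_coeff) \<le> 2"
    by simp
  have "quad_coeff * lin_coeff - [:0, 1:] * a = [:c2\<^sup>2, 2 * c2 * c3, c3 * mid_coeff - c2 * c3:]"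
    by (simp add: a coeff_defs algebra_simps power2_eq_square)
  then show "degree (quad_coeff * lin_coeff - [:0, 1:] * a) \<le> 2"
    by simp
  have "quad_coeff * const_coeff - [:0, 1:] * b = [:0, 0, c1 * (c3 - c2):]"
    by (simp add: b coeff_defs algebra_simps)
  then show "degree (quad_coeff * const_coeff - [:0, 1:] * b) \<le> 2"
    by simp
qed

lemma degree_tangency_poly_le: "degree tangency_poly \<le> 3 * q + 6"
  unfolding tangency_poly_def using q_gt_2
  by (intro degree_tangent_norm_le degree_wronskians degree_monom_le) (simp_all add: coeff_defs)

lemma poly_tangency_poly:
  "poly tangency_poly y = tangent_norm q y (y ^ q) (c2 + c3 * y) (c2 + mid_coeff * y + c3 * y\<^sup>2)
    (c1 * y + c1 * y\<^sup>2) c3 (mid_coeff + 2 * c3 * y) (c1 + 2 * c1 * y)"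
  by (simp add: tangency_poly_def poly_tangent_norm poly_coeffs pderiv_coeffs poly_monom mult_ac)

lemma tangency_poly_nonzero:
  assumes "\<not> (c1 = c2 \<and> m = c1)"
  shows "tangency_poly \<noteq> 0"
proof (cases "c1 = c2")
  case False
  have lucas: "lucas_diff c2 0 n = - c2 * (- c2) ^ n" if "n > 0" for n
    using lucas_diff_eq[of "- c2" 0 c2 0 n] that by (simp add: power_0_left)
  have "poly tangency_poly 0 = c2 ^ q * c2 ^ 3 * (c1 - c2)"
    using q_gt_2
    by (simp add: poly_tangency_poly tangent_norm_def Let_def power_0_left lucas power_q_minus
        power2_eq_square power3_eq_cube algebra_simps)
  then show ?thesis
    using conjugates_nonzero False by auto
next
  case True
  then have c: "c2 = c1" "c3 = c1"
    using conjugates by auto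
  have "poly tangency_poly (- 1) = - (c1\<^sup>2 * (m - c1) ^ 3)"
    unfolding poly_tangency_poly unfolding mid_coeff_def unfolding c using q_gt_2
    by (simp add: tangent_norm_def Let_def power_0_left power_q_minus power2_eq_square
        power3_eq_cube algebra_simps)
  then show ?thesis
    using c1_nonzero True assms by auto
qed

theorem exists_frobenius_orbit_zero:
  assumes general: "\<not> (c1 = c2 \<and> m = c1)"
  shows "\<exists>v. v \<noteq> 0 \<and> v ^ q ^ 3 = v \<and> cubic v (v ^ q) (v ^ q\<^sup>2) = 0"
proof (rule ccontr)
  assume no_orbit: "\<not> ?thesis"
  have root: "poly (pderiv coincidence_poly) y \<noteq> 0 \<and> jet y tangency_poly = 0"
    if y: "poly coincidence_poly y = 0" for y
  proof -
    obtain x where x: "x ^ q = y * y ^ q"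
      using nth_root_exists[of q "y * y ^ q"] q_gt_2 by auto
    have "1 / y ^ q \<noteq> x"
      using orbit_zero_if_points_coincide[OF y] no_orbit x by auto
    then interpret coincidence_root q c1 c2 c3 m y "1 / y ^ q" x
      using y x general by unfold_locales simp_all
    show ?thesis
      using root_simple tangency_double_root by blast
  qed
  have "coincidence_poly \<noteq> 0"
    using degree_coincidence_poly by auto
  then have "card {y. poly coincidence_poly y = 0} = 2 * q + 2"
    using card_simple_roots[of coincidence_poly] root degree_coincidence_poly by simp
  moreover have "2 * card {y. poly coincidence_poly y = 0} \<le> degree tangency_poly"
    using root
    by (intro card_double_roots_le_degree tangency_poly_nonzero general)
      (simp_all add: jet_eq_0_iff)
  ultimately show False
    using degree_tangency_poly_le q_gt_2 by simp
qed

end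

section \<open>The Frobenius map and the cubic extension of a finite field\<close>

lemma power_CARD_eq_self: "x ^ CARD('a) = x" for x :: "'a::{field,finite}"
proof (cases "x = 0")
  case False
  have "(\<Prod>y\<in>UNIV - {0}. y) = (\<Prod>y\<in>UNIV - {0}. x * y)"
    by (rule prod.reindex_bij_witness[of _ "\<lambda>y. x * y" "\<lambda>y. y / x"]) (use False in auto)
  also have "\<dots> = x ^ (CARD('a) - 1) * (\<Prod>y\<in>UNIV - {0}. y)"
    by (simp add: prod.distrib)
  finally have "x ^ (CARD('a) - 1) = 1"
    by simp
  moreover have "x ^ CARD('a) = x * x ^ (CARD('a) - 1)"
    by (cases "CARD('a)") simp_all
  ultimately show ?thesis
    by simp
qed (simp add: power_0_left)

lemma CARD_field_ge_2: "2 \<le> CARD('a::{field,finite})"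
  using card_mono[of UNIV "{0, 1 :: 'a}"] by simp

lemma of_nat_CARD_choose_eq_0:
  assumes "0 < i" "i < CARD('a)"
  shows "of_nat (CARD('a) choose i) = (0 :: 'a::{field,finite})"
proof -
  let ?q = "CARD('a)"
  define p where "p = [:1, 1 :: 'a:] ^ ?q - monom 1 ?q - 1"
  have "degree p < ?q"
  proof -
    have "degree p \<le> ?q"
      unfolding p_def
      by (intro degree_diff_le) (auto simp: degree_power_eq degree_monom_eq)
    moreover have "coeff p ?q = 0"
      by (simp add: p_def coeff_linear_power)
    ultimately show ?thesis
      using CARD_field_ge_2[where 'a = 'a]
      by (metis coeff_0 degree_0 le_neq_implies_less leading_coeff_0_iff not_numeral_le_zero)
  qed
  moreover have "poly p x = 0" for x
    by (simp add: p_def poly_monom power_CARD_eq_self)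
  ultimately have "p = 0"
    using card_poly_roots_bound[of p] by (cases "p = 0") auto
  then have "coeff p i = 0"
    by simp
  then show ?thesis
    using assms by (simp add: p_def coeff_linear_poly_power)
qed

lemma of_nat_CARD_eq_0: "of_nat CARD('a) = (0 :: 'a::{field,finite})"
  using of_nat_CARD_choose_eq_0[of 1, where 'a = 'a] CARD_field_ge_2[where 'a = 'a] by simp

lemma of_nat_CARD_alg_closure: "of_nat CARD('a) = (0 :: 'a::{field,finite} alg_closure)"
  using of_nat_CARD_eq_0[where 'a = 'a] by (metis to_ac_0 to_ac_of_nat)

lemma even_CARD_iff: "even CARD('a::{field,finite}) \<longleftrightarrow> (2 :: 'a) = 0"
proof
  assume "even CARD('a)"
  then have "(- 1 :: 'a) ^ CARD('a) = 1"
    by simp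
  then show "(2 :: 'a) = 0"
    by (simp add: power_CARD_eq_self eq_neg_iff_add_eq_0)
next
  assume two: "(2 :: 'a) = 0"
  show "even CARD('a)"
  proof (rule ccontr)
    assume "odd CARD('a)"
    then have "of_nat CARD('a) = (1 :: 'a)"
      using two by (auto elim: oddE)
    then show False
      by (simp add: of_nat_CARD_eq_0)
  qed
qed

lemma card_power_fixed:
  assumes "of_nat n = (0 :: 'k::alg_closed_field)" "1 < n"
  shows "card {x :: 'k. x ^ n = x} = n"
proof -
  define p where "p = monom 1 n - [:0, 1 :: 'k:]"
  have degree: "degree p = n"
    unfolding p_def using assms(2)
    by (subst diff_conv_add_uminus, subst degree_add_eq_left) (auto simp: degree_monom_eq)
  have "poly (pderiv p) x = - 1" for x
    by (simp add: p_def pderiv_diff pderiv_monom pderiv_pCons assms(1))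
  then have "card {x. poly p x = 0} = n"
    using card_simple_roots[of p] degree assms(2) by fastforce
  then show ?thesis
    by (simp add: p_def poly_monom)
qed

definition frob :: "'a::{field,finite} alg_closure \<Rightarrow> 'a alg_closure" where
  "frob x = x ^ CARD('a)"

lemma frob_add [simp]: "frob (x + y) = frob x + frob y"
  for x y :: "'a::{field,finite} alg_closure"
proof -
  let ?q = "CARD('a)"
  have inner: "of_nat (?q choose k) = (0 :: 'a alg_closure)" if "0 < k" "k < ?q" for k
    using of_nat_CARD_choose_eq_0[where 'a = 'a, OF that] by (metis to_ac_0 to_ac_of_nat)
  have "(x + y) ^ ?q = (\<Sum>k\<le>?q. of_nat (?q choose k) * x ^ k * y ^ (?q - k))"
    by (rule binomial_ring)
  also have "\<dots> = (\<Sum>k\<in>{0, ?q}. of_nat (?q choose k) * x ^ k * y ^ (?q - k))"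
    by (rule sum.mono_neutral_right) (auto simp: inner)
  also have "\<dots> = x ^ ?q + y ^ ?q"
    by (simp add: add.commute)
  finally show ?thesis
    by (simp add: frob_def)
qed

lemma frob_0 [simp]: "frob 0 = 0" and frob_1 [simp]: "frob 1 = 1"
  and frob_mult [simp]: "frob (x * y) = frob x * frob y"
  and frob_divide [simp]: "frob (x / y) = frob x / frob y"
  by (simp_all add: frob_def power_0_left power_mult_distrib power_divide)

lemma frob_power [simp]: "frob (x ^ n) = frob x ^ n"
  by (induction n) simp_all

lemma frob_diff [simp]: "frob (x - y) = frob x - frob y"
  using frob_add[of "x - y" y] by (simp add: algebra_simps del: frob_add)

lemma frob_minus [simp]: "frob (- x) = - frob x"
  using frob_diff[of 0 x] by (simp del: frob_diff)

lemma frob_eq_0_iff [simp]: "frob x = 0 \<longleftrightarrow> x = 0"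
  by (simp add: frob_def)

lemma frob_eq_iff [simp]: "frob x = frob y \<longleftrightarrow> x = y"
  using frob_eq_0_iff[of "x - y"] by (simp del: frob_eq_0_iff)

lemma frob_to_ac [simp]: "frob (to_ac x) = to_ac x"
  by (simp add: frob_def power_CARD_eq_self flip: to_ac_power)

lemma frob_numeral [simp]: "frob (numeral n) = numeral n"
  using frob_to_ac[of "numeral n"] by simp

lemma frob_sum [simp]: "frob (\<Sum>i\<in>A. f i) = (\<Sum>i\<in>A. frob (f i))"
  by (induction A rule: infinite_finite_induct) auto

lemma frob_iterates:
  "frob (frob x) = x ^ (CARD('a))\<^sup>2" "frob (frob (frob x)) = x ^ CARD('a) ^ 3"
  for x :: "'a::{field,finite} alg_closure"
  by (simp_all add: frob_def power2_eq_square power3_eq_cube flip: power_mult)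

lemma frob_fixed_iff: "frob x = x \<longleftrightarrow> x \<in> range to_ac"
  for x :: "'a::{field,finite} alg_closure"
proof -
  have "card {x :: 'a alg_closure. frob x = x} = CARD('a)"
    unfolding frob_def using CARD_field_ge_2[where 'a = 'a]
    by (intro card_power_fixed of_nat_CARD_alg_closure) simp
  then have "range to_ac = {x :: 'a alg_closure. frob x = x}"
    using CARD_field_ge_2[where 'a = 'a]
    by (intro card_seteq) (auto intro: card_ge_0_finite simp: card_image inj_to_ac)
  then show ?thesis
    by auto
qed

definition cubic_field :: "'a::{field,finite} alg_closure set" where
  "cubic_field = {x. frob (frob (frob x)) = x}"

lemma frob3 [simp]: "x \<in> cubic_field \<Longrightarrow> frob (frob (frob x)) = x"
  by (simp add: cubic_field_def)

lemma cubic_field_closed [simp, intro]: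
  "0 \<in> cubic_field" "1 \<in> cubic_field" "numeral k \<in> cubic_field" "to_ac r \<in> cubic_field"
  "x \<in> cubic_field \<Longrightarrow> frob x \<in> cubic_field"
  "x \<in> cubic_field \<Longrightarrow> - x \<in> cubic_field"
  "x \<in> cubic_field \<Longrightarrow> x ^ n \<in> cubic_field"
  "x \<in> cubic_field \<Longrightarrow> y \<in> cubic_field \<Longrightarrow> x + y \<in> cubic_field"
  "x \<in> cubic_field \<Longrightarrow> y \<in> cubic_field \<Longrightarrow> x - y \<in> cubic_field"
  "x \<in> cubic_field \<Longrightarrow> y \<in> cubic_field \<Longrightarrow> x * y \<in> cubic_field"
  "x \<in> cubic_field \<Longrightarrow> y \<in> cubic_field \<Longrightarrow> x / y \<in> cubic_field"
  by (simp_all only: cubic_field_def mem_Collect_eq frob_0 frob_1 frob_numeral frob_to_ac frob_minus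
      frob_power frob_add frob_diff frob_mult frob_divide)

lemma card_cubic_field: "card (cubic_field :: 'a::{field,finite} alg_closure set) = CARD('a) ^ 3"
proof -
  have "of_nat (CARD('a) ^ 3) = (0 :: 'a alg_closure)"
    by (simp add: of_nat_CARD_alg_closure)
  moreover have "1 < CARD('a) ^ 3"
    using CARD_field_ge_2[where 'a = 'a] by (intro one_less_power) auto
  ultimately show ?thesis
    unfolding cubic_field_def frob_iterates(2) by (rule card_power_fixed)
qed

lemma exists_cubic_generator:
  obtains t :: "'a::{field,finite} alg_closure" where "t \<in> cubic_field" "frob t \<noteq> t"
proof -
  have "\<not> cubic_field \<subseteq> range (to_ac :: 'a \<Rightarrow> _)"
  proof
    assume "cubic_field \<subseteq> range (to_ac :: 'a \<Rightarrow> _)"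
    then have "card (cubic_field :: 'a alg_closure set) \<le> card (range (to_ac :: 'a \<Rightarrow> _))"
      by (intro card_mono) auto
    then have "CARD('a) ^ 3 \<le> CARD('a)"
      by (simp add: card_cubic_field card_image inj_to_ac)
    then show False
      using CARD_field_ge_2[where 'a = 'a] power_strict_increasing[of 1 3 "CARD('a)"] by simp
  qed
  then show ?thesis
    using that frob_fixed_iff by blast
qed

lemma cubic_generator_distinct:
  assumes "t \<in> cubic_field" "frob t \<noteq> t"
  shows "frob (frob t) \<noteq> t" "frob (frob t) \<noteq> frob t"
  using assms by (metis frob3, simp)

definition Tr :: "'a::{field,finite} alg_closure \<Rightarrow> 'a alg_closure" where
  "Tr x = x + frob x + frob (frob x)"

definition Nm :: "'a::{field,finite} alg_closure \<Rightarrow> 'a alg_closure" where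
  "Nm x = x * frob x * frob (frob x)"

lemma Tr_0 [simp]: "Tr 0 = 0"
  and Tr_add: "Tr (x + y) = Tr x + Tr y"
  and Tr_diff: "Tr (x - y) = Tr x - Tr y"
  and Tr_1: "Tr 1 = 3"
  by (simp_all add: Tr_def)

lemma Tr_mult_fixed: "frob c = c \<Longrightarrow> Tr (c * x) = c * Tr x"
  by (simp add: Tr_def algebra_simps)

lemma frob_Tr [simp]: "x \<in> cubic_field \<Longrightarrow> frob (Tr x) = Tr x"
  by (simp add: Tr_def add_ac)

lemma frob_Nm [simp]: "x \<in> cubic_field \<Longrightarrow> frob (Nm x) = Nm x"
  by (simp add: Nm_def mult_ac)

lemma Nm_eq_0_iff [simp]: "Nm x = 0 \<longleftrightarrow> x = 0"
  by (simp add: Nm_def)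

lemma Tr_in_base:
  assumes "x \<in> cubic_field"
  obtains r where "Tr x = to_ac r"
  using frob_Tr[OF assms] frob_fixed_iff by blast

lemma exists_Tr_nonzero:
  obtains z :: "'a::{field,finite} alg_closure" where "z \<in> cubic_field" "Tr z \<noteq> 0"
proof -
  obtain t :: "'a alg_closure" where t: "t \<in> cubic_field" "frob t \<noteq> t"
    by (rule exists_cubic_generator)
  have "(t - frob t) * (t - frob (frob t)) =
      Tr (t\<^sup>2) - (frob t + frob (frob t)) * Tr t + frob t * frob (frob t) * Tr 1"
    by (simp add: Tr_def algebra_simps power2_eq_square)
  moreover have "(t - frob t) * (t - frob (frob t)) \<noteq> 0"
    using t cubic_generator_distinct[OF t] by simp
  ultimately have "Tr (t\<^sup>2) \<noteq> 0 \<or> Tr t \<noteq> 0 \<or> Tr (1 :: 'a alg_closure) \<noteq> 0"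
    by auto
  then show ?thesis
    using that t(1) by blast
qed

lemma exists_trace_norm_solution:
  fixes c m :: "'a::{field,finite} alg_closure"
  assumes "2 < CARD('a)" "c \<in> cubic_field" "c \<noteq> 0" "frob m = m" "\<not> (frob c = c \<and> m = c)"
  obtains v where "v \<in> cubic_field" "v \<noteq> 0" "Tr v * Tr (c * frob v * frob (frob v)) = m * Nm v"
proof -
  have pow: "v ^ CARD('a) = frob v" "v ^ (CARD('a))\<^sup>2 = frob (frob v)"
    "v ^ CARD('a) ^ 3 = frob (frob (frob v))" for v :: "'a alg_closure"
    by (rule frob_def[symmetric] frob_iterates[symmetric])+
  interpret conjugate_cubic "CARD('a)" c "frob c" "frob (frob c)" m
    using assms by unfold_locales (simp_all add: pow of_nat_CARD_alg_closure)
  obtain v where v: "v \<noteq> 0" "frob (frob (frob v)) = v" "cubic v (frob v) (frob (frob v)) = 0"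
    using exists_frobenius_orbit_zero assms(5) unfolding pow by auto
  moreover have "Tr v * Tr (c * frob v * frob (frob v)) = m * Nm v"
    using v(2,3) by (simp add: conj_cubic_def Tr_def Nm_def mult_ac)
  moreover have "v \<in> cubic_field"
    using v(2) by (simp only: cubic_field_def mem_Collect_eq)
  ultimately show ?thesis
    using that by blast
qed

lemma poly_map_to_ac [simp]: "poly (map_poly to_ac p) (to_ac x) = to_ac (poly p x)"
  by (induction p) (simp_all add: map_poly_pCons)

lemma poly_map_to_ac_mult_add:
  "poly (map_poly to_ac (p * r + s)) x =
    poly (map_poly to_ac p) x * poly (map_poly to_ac r) x + poly (map_poly to_ac s) x"
proof -
  have "map_poly to_ac (p * r + s) = map_poly to_ac p * map_poly to_ac r + map_poly to_ac s"
    by (simp add: poly_eq_iff coeff_map_poly coeff_mult to_ac_sum)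
  then show ?thesis
    by simp
qed

lemma frob_poly_map_to_ac:
  "frob (poly (map_poly to_ac p) x) = poly (map_poly to_ac p) (frob x)"
  by (induction p) (simp_all add: map_poly_pCons)

lemma quadratic_element_factor:
  fixes p :: "'a::{field,finite} poly"
  assumes root: "poly (map_poly to_ac p) t = 0" and t: "frob (frob t) = t" "frob t \<noteq> t"
  obtains g where "degree g = 2" "g dvd p"
proof -
  have "frob (t + frob t) = t + frob t" "frob (t * frob t) = t * frob t"
    by (simp_all add: t add.commute mult.commute)
  then obtain s n where sn: "t + frob t = to_ac s" "t * frob t = to_ac n"
    using frob_fixed_iff by (metis image_iff)
  define g where "g = [:n, - s, 1:]"
  have g: "degree g = 2"
    by (simp add: g_def)
  have "poly (map_poly to_ac g) t = 0"
    by (simp add: g_def map_poly_pCons algebra_simps flip: sn)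
  then have rem: "poly (map_poly to_ac (p mod g)) t = 0"
    using root poly_map_to_ac_mult_add[of "p div g" g "p mod g" t] by simp
  have "degree (p mod g) < 2"
    using degree_mod_less[of g p] g by fastforce
  then have "p mod g = [:coeff (p mod g) 0, coeff (p mod g) 1:]"
    by (simp add: poly_eq_iff coeff_pCons coeff_eq_0 split: nat.split)
  then obtain r0 r1 where r: "p mod g = [:r0, r1:]"
    by blast
  have r1: "r1 = 0"
  proof (rule ccontr)
    assume "r1 \<noteq> 0"
    then have "t = to_ac (- r0 / r1)"
      using rem by (simp add: r map_poly_pCons field_simps eq_neg_iff_add_eq_0)
    then show False
      using t(2) by simp
  qed
  then have "p mod g = 0"
    using rem by (simp add: r map_poly_pCons)
  with g that show ?thesis
    by (auto simp: dvd_eq_mod_eq_0)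
qed

lemma root_if_quadratic_dvd_cubic:
  fixes p :: "'a::field poly"
  assumes "degree p = 3" "degree g = 2" "g dvd p"
  shows "\<exists>x. poly p x = 0"
proof -
  obtain k where k: "p = g * k"
    using assms(3) by blast
  then have "degree k = 1"
    using assms(1,2) by (cases "g = 0 \<or> k = 0") (auto simp: degree_mult_eq)
  then obtain k0 k1 where "k = [:k0, k1:]" "k1 \<noteq> 0"
    by (rule degree1_coeffs)
  then have "poly p (- k0 / k1) = 0"
    by (simp add: k)
  then show ?thesis ..
qed

lemma rootfree_cubic_root:
  fixes p :: "'a::{field,finite} poly"
  assumes degree: "degree p = 3" and rootfree: "\<And>x. poly p x \<noteq> 0"
  obtains t where "poly (map_poly to_ac p) t = 0" "t \<in> cubic_field" "frob t \<noteq> t"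
proof -
  let ?p = "map_poly to_ac p"
  have deg: "degree ?p = 3"
    using degree by (simp add: degree_map_poly)
  then obtain t where t: "poly ?p t = 0"
    using alg_closed_imp_poly_has_root[of ?p] by auto
  have not_base: "frob t \<noteq> t"
    using t rootfree frob_fixed_iff[of t] by auto
  have not_quadratic: "frob (frob t) \<noteq> t"
  proof
    assume "frob (frob t) = t"
    then obtain g where g: "degree g = 2" "g dvd p"
      using quadratic_element_factor t not_base by blast
    then show False
      using root_if_quadratic_dvd_cubic[OF degree] rootfree by blast
  qed
  have "t \<in> cubic_field"
  proof (rule ccontr)
    assume "t \<notin> cubic_field"
    then have "card {t, frob t, frob (frob t), frob (frob (frob t))} = 4"
      using not_base not_quadratic by (auto simp: cubic_field_def card_insert_if simp del: frob3)
    moreover have "?p \<noteq> 0"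
      using deg by auto
    then have "card {t, frob t, frob (frob t), frob (frob (frob t))} \<le> card {x. poly ?p x = 0}"
      using t by (intro card_mono poly_roots_finite) (simp_all flip: frob_poly_map_to_ac)
    moreover have "card {x. poly ?p x = 0} \<le> 3"
      using card_poly_roots_bound[OF \<open>?p \<noteq> 0\<close>] deg by simp
    ultimately show False
      by simp
  qed
  with t not_base that show ?thesis
    by blast
qed

section \<open>Frobenius frames and Gram matrices\<close>

abbreviation lift_mat :: "'a::field^'n^'m \<Rightarrow> 'a alg_closure^'n^'m" where
  "lift_mat \<equiv> map_matrix to_ac"

abbreviation frob_mat :: "'a::{field,finite} alg_closure^'n^'m \<Rightarrow> 'a alg_closure^'n^'m" where
  "frob_mat \<equiv> map_matrix frob"

lemma transpose_map_matrix: "transpose (map_matrix f A) = map_matrix f (transpose A)"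
  by (simp add: vec_eq_iff transpose_def)

lemma transpose_0: "transpose 0 = 0"
  and transpose_add_mat: "transpose (M + N) = transpose M + transpose N"
  and transpose_mat_scale: "transpose (mat_scale c M) = mat_scale c (transpose M)"
  by (simp_all add: vec_eq_iff transpose_def mat_scale_def)

lemma lift_mat_mult: "lift_mat (A ** B) = lift_mat A ** lift_mat B"
  by (simp add: vec_eq_iff matrix_matrix_mult_def to_ac_sum)

lemma lift_mat_1 [simp]: "lift_mat (mat 1) = mat 1"
  by (simp add: vec_eq_iff mat_def)

lemma lift_mat_eq_iff [simp]: "lift_mat A = lift_mat B \<longleftrightarrow> A = B"
  by (simp add: vec_eq_iff)

lemma det_lift_mat: "det (lift_mat A) = to_ac (det A)"
  by (simp add: det_def to_ac_sum to_ac_prod)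

lemma frob_mat_mult: "frob_mat (A ** B) = frob_mat A ** frob_mat B"
  by (simp add: vec_eq_iff matrix_matrix_mult_def)

lemma frob_mat_1 [simp]: "frob_mat (mat 1) = mat 1"
  by (simp add: vec_eq_iff mat_def)

lemma frob_mat_lift_mat [simp]: "frob_mat (lift_mat A) = lift_mat A"
  by (simp add: vec_eq_iff)

lemma frob_mat_fixed_imp_lift_mat:
  assumes "frob_mat A = A"
  obtains B where "A = lift_mat B"
proof
  have "A $ i $ j \<in> range to_ac" for i j
    using assms by (simp add: vec_eq_iff flip: frob_fixed_iff)
  then show "A = lift_mat (map_matrix of_ac A)"
    by (simp add: vec_eq_iff to_ac_of_ac)
qed

definition cyc :: "'k::comm_ring_1^3^3" where
  "cyc = vector [vector [0, 0, 1], vector [1, 0, 0], vector [0, 1, 0]]"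

lemma mult_cyc: "(A ** cyc) $ i $ 1 = A $ i $ 2" "(A ** cyc) $ i $ 2 = A $ i $ 3"
    "(A ** cyc) $ i $ 3 = A $ i $ 1"
  and transpose_cyc_mult: "(transpose cyc ** A) $ 1 $ i = A $ 2 $ i"
    "(transpose cyc ** A) $ 2 $ i = A $ 3 $ i" "(transpose cyc ** A) $ 3 $ i = A $ 1 $ i"
  by (simp_all add: matrix_matrix_mult_def sum_3 cyc_def transpose_def)

lemma cyc_orthogonal: "cyc ** transpose cyc = mat 1" "transpose cyc ** cyc = mat 1"
  by (simp_all add: vec_eq_iff forall_3 matrix_matrix_mult_def sum_3 cyc_def transpose_def mat_def)

definition frob_frame :: "'a::{field,finite} alg_closure^3^3 \<Rightarrow> bool" where
  "frob_frame P \<longleftrightarrow> invertible P \<and> frob_mat P = P ** cyc"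

lemma invertible_frob_frame: "frob_frame P \<Longrightarrow> invertible P"
  by (simp add: frob_frame_def)

definition frob_circulant :: "'a::{field,finite} alg_closure^3^3 \<Rightarrow> bool" where
  "frob_circulant H \<longleftrightarrow> frob_mat H = transpose cyc ** H ** cyc"

lemma frob_circulant_iff:
  "frob_circulant H \<longleftrightarrow>
    frob (H $ 1 $ 1) = H $ 2 $ 2 \<and> frob (H $ 2 $ 2) = H $ 3 $ 3 \<and> frob (H $ 3 $ 3) = H $ 1 $ 1 \<and>
    frob (H $ 1 $ 2) = H $ 2 $ 3 \<and> frob (H $ 2 $ 3) = H $ 3 $ 1 \<and> frob (H $ 3 $ 1) = H $ 1 $ 2 \<and>
    frob (H $ 2 $ 1) = H $ 3 $ 2 \<and> frob (H $ 3 $ 2) = H $ 1 $ 3 \<and> frob (H $ 1 $ 3) = H $ 2 $ 1"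
  unfolding frob_circulant_def vec_eq_iff forall_3 mult_cyc transpose_cyc_mult nth_map_matrix
  by (rule iffI; elim conjE; intro conjI; assumption)

lemma frob_frame_mult_circulant:
  assumes "frob_frame P" "frob_circulant H" "invertible H"
  shows "frob_frame (P ** H)"
proof -
  have "frob_mat (P ** H) = P ** (cyc ** transpose cyc) ** H ** cyc"
    using assms unfolding frob_frame_def frob_circulant_def
    by (simp only: frob_mat_mult matrix_mul_assoc)
  then show ?thesis
    using assms by (simp add: frob_frame_def cyc_orthogonal invertible_mult)
qed

lemma frob_frame_inverse:
  assumes "frob_frame P"
  obtains Q where "P ** Q = mat 1" "Q ** P = mat 1" "frob_mat Q = transpose cyc ** Q"
proof -
  obtain Q where Q: "P ** Q = mat 1" "Q ** P = mat 1"
    using assms unfolding frob_frame_def invertible_def by blast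
  have "frob_mat P ** frob_mat Q = mat 1"
    by (simp flip: frob_mat_mult add: Q)
  then have "P ** cyc ** frob_mat Q = mat 1"
    using assms by (simp add: frob_frame_def)
  then have "transpose cyc ** (Q ** P) ** cyc ** frob_mat Q = transpose cyc ** Q"
    by (metis matrix_mul_assoc matrix_mul_rid)
  then have "frob_mat Q = transpose cyc ** Q"
    by (simp add: Q cyc_orthogonal)
  with Q that show ?thesis
    by blast
qed

lemma frob_frames_related:
  assumes "frob_frame P" "frob_frame Q"
  obtains A where "invertible A" "P = lift_mat A ** Q"
proof -
  obtain R where R: "Q ** R = mat 1" "R ** Q = mat 1" "frob_mat R = transpose cyc ** R"
    using frob_frame_inverse[OF assms(2)] .
  have "frob_mat (P ** R) = P ** (cyc ** transpose cyc) ** R"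
    using assms(1) R(3) by (simp only: frob_mat_mult frob_frame_def matrix_mul_assoc)
  then have "frob_mat (P ** R) = P ** R"
    by (simp add: cyc_orthogonal)
  then obtain A where A: "P ** R = lift_mat A"
    using frob_mat_fixed_imp_lift_mat by blast
  have "invertible R"
    using R unfolding invertible_def by blast
  then have "invertible (lift_mat A)"
    using assms(1) invertible_mult A unfolding frob_frame_def by metis
  then have "invertible A"
    by (simp add: invertible_det_nz det_lift_mat)
  moreover have "P = lift_mat A ** Q"
    unfolding A[symmetric] by (simp add: R flip: matrix_mul_assoc)
  ultimately show ?thesis
    using that by blast
qed

definition frob_cols :: "'a::{field,finite} alg_closure^3 \<Rightarrow> 'a alg_closure^3^3" where
  "frob_cols v = (\<chi> i. vector [v $ i, frob (v $ i), frob (frob (v $ i))])"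

lemma frob_cols_nth [simp]:
  "frob_cols v $ i $ 1 = v $ i" "frob_cols v $ i $ 2 = frob (v $ i)"
  "frob_cols v $ i $ 3 = frob (frob (v $ i))"
  by (simp_all add: frob_cols_def)

lemma frob_frame_frob_cols:
  assumes "invertible (frob_cols v)" "\<And>i. v $ i \<in> cubic_field"
  shows "frob_frame (frob_cols v)"
  using assms by (simp add: frob_frame_def vec_eq_iff forall_3 mult_cyc)

lemma invertible_power_frame:
  assumes "t \<in> cubic_field" "frob t \<noteq> t"
  shows "invertible (frob_cols (vector [1, t, t\<^sup>2]))"
proof -
  have "det (frob_cols (vector [1, t, t\<^sup>2])) =
      (frob t - t) * (frob (frob t) - t) * (frob (frob t) - frob t)"
    by (simp add: det_3 power2_eq_square algebra_simps)
  then show ?thesis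
    using assms cubic_generator_distinct[OF assms] by (simp add: invertible_det_nz)
qed

lemma exists_frob_frame: "\<exists>P :: 'a::{field,finite} alg_closure^3^3. frob_frame P"
proof -
  obtain t :: "'a alg_closure" where t: "t \<in> cubic_field" "frob t \<noteq> t"
    by (rule exists_cubic_generator)
  have "(vector [1, t, t\<^sup>2] :: 'a alg_closure^3) $ i \<in> cubic_field" for i
    using exhaust_3[of i] t(1) by auto
  then show ?thesis
    using frob_frame_frob_cols[OF invertible_power_frame[OF t]] by blast
qed

definition sym_circulant ::
  "'a::{field,finite} alg_closure \<Rightarrow> 'a alg_closure \<Rightarrow> 'a alg_closure^3^3" where
  "sym_circulant a b = vector [vector [a, b, frob (frob b)], vector [b, frob a, frob b],
     vector [frob (frob b), frob b, frob (frob a)]]"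

lemma sym_circulant_nth [simp]:
  "sym_circulant a b $ 1 $ 1 = a" "sym_circulant a b $ 1 $ 2 = b"
  "sym_circulant a b $ 1 $ 3 = frob (frob b)" "sym_circulant a b $ 2 $ 1 = b"
  "sym_circulant a b $ 2 $ 2 = frob a" "sym_circulant a b $ 2 $ 3 = frob b"
  "sym_circulant a b $ 3 $ 1 = frob (frob b)" "sym_circulant a b $ 3 $ 2 = frob b"
  "sym_circulant a b $ 3 $ 3 = frob (frob a)"
  by (simp_all add: sym_circulant_def)

lemma sym_circulant_eq_iff [simp]: "sym_circulant a b = sym_circulant c d \<longleftrightarrow> a = c \<and> b = d"
  by (auto simp: vec_eq_iff forall_3)

lemma sym_circulant_0: "sym_circulant 0 0 = 0"
  and sym_circulant_1: "sym_circulant 1 0 = mat 1"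
  and sym_circulant_add: "sym_circulant (a + c) (b + d) = sym_circulant a b + sym_circulant c d"
  and sym_circulant_scale:
    "sym_circulant (to_ac r * a) (to_ac r * b) = mat_scale (to_ac r) (sym_circulant a b)"
  and transpose_sym_circulant [simp]: "transpose (sym_circulant a b) = sym_circulant a b"
  by (simp_all add: vec_eq_iff forall_3 mat_def mat_scale_def transpose_def)

lemma frob_circulant_sym_circulant:
  "a \<in> cubic_field \<Longrightarrow> b \<in> cubic_field \<Longrightarrow> frob_circulant (sym_circulant a b)"
  by (simp add: frob_circulant_iff)

lemma sym_circulant_mult_diag:
  "sym_circulant x 0 ** sym_circulant y 0 = sym_circulant (x * y) 0"
  by (simp add: vec_eq_iff forall_3 matrix_matrix_mult_def sum_3)

lemma sym_circulant_congruence_diag: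
  assumes "s \<in> cubic_field"
  shows "sym_circulant s 0 ** sym_circulant a b ** sym_circulant s 0 =
    sym_circulant (s\<^sup>2 * a) (s * frob s * b)"
  by (simp add: vec_eq_iff forall_3 matrix_matrix_mult_def sum_3 power2_eq_square assms)

lemma det_sym_circulant: "det (sym_circulant a b) = Nm a + 2 * Nm b
    - a * (frob b)\<^sup>2 - frob a * (frob (frob b))\<^sup>2 - frob (frob a) * b\<^sup>2"
  by (simp add: det_3 Nm_def power2_eq_square algebra_simps)

definition gram :: "'a::field alg_closure^3^3 \<Rightarrow> 'a^3^3 \<Rightarrow> 'a alg_closure^3^3" where
  "gram P M = transpose P ** lift_mat M ** P"

lemma gram_nth: "gram P M $ i $ j = (\<Sum>k\<in>UNIV. \<Sum>l\<in>UNIV. P $ l $ i * to_ac (M $ l $ k) * P $ k $ j)"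
  by (simp add: gram_def matrix_matrix_mult_def transpose_def sum_distrib_right)

lemma gram_0 [simp]: "gram P 0 = 0"
  and gram_add: "gram P (M + N) = gram P M + gram P N"
  and gram_scale: "gram P (mat_scale c M) = mat_scale (to_ac c) (gram P M)"
  by (simp_all add: vec_eq_iff gram_nth mat_scale_def sum_3 algebra_simps)

lemma transpose_gram: "transpose M = M \<Longrightarrow> transpose (gram P M) = gram P M"
  by (simp add: gram_def matrix_transpose_mul transpose_map_matrix matrix_mul_assoc)

lemma det_gram: "det (gram P M) = (det P)\<^sup>2 * to_ac (det M)"
  by (simp add: gram_def det_mul det_lift_mat power2_eq_square)

lemma gram_mult: "gram (P ** S) M = transpose S ** gram P M ** S"
  by (simp add: gram_def matrix_transpose_mul matrix_mul_assoc)

lemma gram_lift_mult: "gram (lift_mat A ** Q) M = gram Q (transpose A ** M ** A)"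
  by (simp add: gram_def lift_mat_mult matrix_transpose_mul transpose_map_matrix matrix_mul_assoc)

lemma gram_eq_iff:
  assumes "invertible P"
  shows "gram P M = gram P N \<longleftrightarrow> M = N"
proof
  obtain Q where Q: "P ** Q = mat 1"
    using assms unfolding invertible_def by blast
  have "transpose Q ** gram P M ** Q = lift_mat M" for M
  proof -
    have "transpose Q ** gram P M ** Q = transpose (P ** Q) ** lift_mat M ** (P ** Q)"
      by (simp add: gram_def matrix_transpose_mul matrix_mul_assoc)
    then show ?thesis
      by (simp add: Q)
  qed
  then show "gram P M = gram P N \<Longrightarrow> M = N"
    by (metis lift_mat_eq_iff)
qed simp

lemma gram_eq_sym_circulant:
  assumes "frob_frame P" "transpose M = M"
  obtains a b where "a \<in> cubic_field" "b \<in> cubic_field" "gram P M = sym_circulant a b"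
proof -
  let ?a = "gram P M $ 1 $ 1" and ?b = "gram P M $ 1 $ 2"
  have circulant: "frob_circulant (gram P M)"
    using assms(1)
    by (simp add: gram_def frob_circulant_def frob_frame_def frob_mat_mult matrix_transpose_mul
        matrix_mul_assoc flip: transpose_map_matrix)
  have sym: "gram P M $ i $ j = gram P M $ j $ i" for i j
    using transpose_gram[OF assms(2), of P] by (simp add: vec_eq_iff transpose_def)
  have "gram P M = sym_circulant ?a ?b"
    using circulant sym[of 1 2] sym[of 1 3] sym[of 2 3] unfolding frob_circulant_iff
    by (auto simp: vec_eq_iff forall_3)
  moreover have "?a \<in> cubic_field" "?b \<in> cubic_field"
    using circulant sym[of 1 2] sym[of 1 3] sym[of 2 3]
    unfolding frob_circulant_iff cubic_field_def mem_Collect_eq by metis+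
  ultimately show ?thesis
    using that by blast
qed

lemma exists_gram_eq_sym_circulant:
  assumes "frob_frame P" "a \<in> cubic_field" "b \<in> cubic_field"
  obtains M where "transpose M = M" "gram P M = sym_circulant a b"
proof -
  let ?H = "sym_circulant a b"
  obtain Q where Q: "P ** Q = mat 1" "Q ** P = mat 1" "frob_mat Q = transpose cyc ** Q"
    using frob_frame_inverse[OF assms(1)] .
  define Z where "Z = transpose Q ** ?H ** Q"
  have "frob_mat Z = transpose Q ** (cyc ** transpose cyc) ** ?H ** (cyc ** transpose cyc) ** Q"
    using frob_circulant_sym_circulant[OF assms(2,3)]
    unfolding Z_def frob_mat_mult transpose_map_matrix[symmetric] Q(3) frob_circulant_def
    by (simp add: matrix_transpose_mul matrix_mul_assoc)
  then have "frob_mat Z = Z"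
    by (simp add: cyc_orthogonal Z_def)
  then obtain M where M: "Z = lift_mat M"
    by (rule frob_mat_fixed_imp_lift_mat)
  have "transpose Z = Z"
    by (simp add: Z_def matrix_transpose_mul matrix_mul_assoc)
  then have "transpose M = M"
    by (simp add: M transpose_map_matrix)
  moreover have "gram P M = transpose (Q ** P) ** ?H ** (Q ** P)"
    by (simp add: gram_def M[symmetric] Z_def matrix_transpose_mul matrix_mul_assoc)
  ultimately show ?thesis
    using that by (simp add: Q)
qed

section \<open>Pencils of symmetric matrices\<close>

definition pencil_poly :: "'a::comm_ring_1^3^3 \<Rightarrow> 'a^3^3 \<Rightarrow> 'a poly" where
  "pencil_poly A B =
    (let D = \<lambda>S. det (\<chi> i. if i \<in> S then B $ i else A $ i)
     in [:D {}, - (D {1} + D {2} + D {3}), D {1, 2} + D {1, 3} + D {2, 3}, - D UNIV:])"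

lemma poly_pencil_poly: "poly (pencil_poly A B) t = det (A - mat_scale t B)"
  for A B :: "'a::field^3^3"
  by (simp add: pencil_poly_def Let_def det_3 mat_scale_def algebra_simps)

lemma map_poly_pencil_poly:
  "map_poly to_ac (pencil_poly A B) = pencil_poly (lift_mat A) (lift_mat B)"
  by (simp add: pencil_poly_def Let_def det_3 map_poly_pCons)

lemma degree_pencil_poly: "det B \<noteq> 0 \<Longrightarrow> degree (pencil_poly A B) = 3"
  by (simp add: pencil_poly_def Let_def vec_lambda_eta)

lemma mat_scale_vector_mult: "mat_scale c A *v v = c *s (A *v v)"
  by (simp add: vec_eq_iff matrix_vector_mult_def mat_scale_def sum_distrib_left mult.assoc)

text \<open>A nonzero kernel vector of minimal support is unique up to scaling.\<close>

lemma exists_fixed_kernel_vector: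
  fixes N :: "'a::field^'n^'m" and f :: "'a \<Rightarrow> 'a"
  assumes hom: "f 1 = 1" "\<And>x y. f (x + y) = f x + f y" "\<And>x y. f (x * y) = f x * f y"
    and fixed: "map_matrix f N = N" and kernel: "N *v u = 0" "u \<noteq> 0"
  obtains v where "N *v v = 0" "v \<noteq> 0" "\<And>i. f (v $ i) = v $ i"
proof -
  have f_0: "f 0 = 0"
    by (metis hom(2) add_0 add_cancel_right_left)
  define supp where "supp v = {i. v $ i \<noteq> 0}" for v :: "'a^'n"
  obtain v where v: "N *v v = 0" "v \<noteq> 0"
    and minimal: "\<And>w. N *v w = 0 \<Longrightarrow> w \<noteq> 0 \<Longrightarrow> card (supp v) \<le> card (supp w)"
    using ex_has_least_nat[of "\<lambda>v. N *v v = 0 \<and> v \<noteq> 0" u "\<lambda>v. card (supp v)"] kernel by blast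
  obtain k where k: "v $ k \<noteq> 0"
    using v(2) by (auto simp: vec_eq_iff)
  define w where "w = (1 / v $ k) *s v"
  have w: "N *v w = 0" "w \<noteq> 0" "w $ k = 1" "supp w = supp v"
    using v k by (auto simp: w_def supp_def vector_scalar_commute)
  have sum: "f (\<Sum>j\<in>J. g j) = (\<Sum>j\<in>J. f (g j))" for g and J :: "'n set"
    by (induction J rule: infinite_finite_induct) (simp_all add: f_0 hom)
  define d where "d = (\<chi> i. f (w $ i) - w $ i)"
  have "N *v (\<chi> i. f (w $ i)) = (\<chi> i. f ((N *v w) $ i))"
    using fixed by (simp add: vec_eq_iff matrix_vector_mult_def sum hom)
  also have "\<dots> = 0"
    by (simp add: w(1) f_0 vec_eq_iff)
  moreover have "d = (\<chi> i. f (w $ i)) - w"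
    by (simp add: d_def vec_eq_iff)
  ultimately have "N *v d = 0"
    by (simp add: matrix_vector_mult_diff_distrib w(1))
  moreover have "supp d \<subset> supp v"
  proof
    show "supp d \<subseteq> supp v"
      unfolding w(4)[symmetric] by (auto simp: supp_def d_def f_0)
    have "k \<notin> supp d" "k \<in> supp v"
      using k by (simp_all add: supp_def d_def hom w(3))
    then show "supp d \<noteq> supp v"
      by blast
  qed
  then have "card (supp d) < card (supp v)"
    by (intro psubset_card_mono) auto
  ultimately have "d = 0"
    using minimal[of d] by linarith
  then show ?thesis
    using that[of w] w by (simp add: d_def vec_eq_iff)
qed

lemma frob_cols_eigenvectors:
  fixes A B :: "'a::{field,finite}^3^3"
  assumes "lift_mat A *v v = t *s (lift_mat B *v v)"
  shows "lift_mat A ** frob_cols v = lift_mat B ** frob_cols v ** sym_circulant t 0"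
proof -
  have conj: "(lift_mat M ** frob_cols v) $ i $ 2 = frob ((lift_mat M ** frob_cols v) $ i $ 1)"
    "(lift_mat M ** frob_cols v) $ i $ 3 = frob ((lift_mat M ** frob_cols v) $ i $ 2)"
    for M :: "'a^3^3" and i
    by (simp_all add: matrix_matrix_mult_def)
  have diag: "(H ** sym_circulant t 0) $ i $ 1 = t * H $ i $ 1"
    "(H ** sym_circulant t 0) $ i $ 2 = frob t * H $ i $ 2"
    "(H ** sym_circulant t 0) $ i $ 3 = frob (frob t) * H $ i $ 3"
    for H :: "'a alg_closure^3^3" and i
    by (simp_all add: matrix_matrix_mult_def sum_3)
  have "(lift_mat A ** frob_cols v) $ i $ 1 = t * (lift_mat B ** frob_cols v) $ i $ 1" for i
    using assms by (simp add: vec_eq_iff matrix_vector_mult_def matrix_matrix_mult_def)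
  then show ?thesis
    by (simp add: vec_eq_iff forall_3 diag conj)
qed

lemma invertible_frob_cols_eigenvector:
  fixes A B :: "'a::{field,finite}^3^3"
  assumes t: "t \<in> cubic_field" "frob t \<noteq> t" and B: "det B \<noteq> 0" and v: "v \<noteq> 0"
    and eigen: "lift_mat A *v v = t *s (lift_mat B *v v)"
  shows "invertible (frob_cols v)"
proof -
  let ?P = "frob_cols v" and ?D = "sym_circulant t 0"
  have kernel: "w = 0" if "M *v w = 0" "invertible M" for M :: "'a alg_closure^3^3" and w
    using that by (metis invertible_left_inverse matrix_left_invertible_ker)
  have invariant: "?P *v (?D *v w) = 0" if "?P *v w = 0" for w
  proof (rule kernel)
    have "lift_mat B *v (?P *v (?D *v w)) = lift_mat A *v (?P *v w)"
      by (simp add: matrix_vector_mul_assoc matrix_mul_assoc frob_cols_eigenvectors[OF eigen])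
    then show "lift_mat B *v (?P *v (?D *v w)) = 0"
      by (simp add: that)
    show "invertible (lift_mat B)"
      using B by (simp add: invertible_det_nz det_lift_mat)
  qed
  have "w = 0" if w: "?P *v w = 0" for w
  proof -
    obtain k where k: "v $ k \<noteq> 0"
      using v by (auto simp: vec_eq_iff)
    define x where "x = (\<chi> j. ?P $ k $ j * w $ j)"
    have "(?P *v w) $ k = 0" "(?P *v (?D *v w)) $ k = 0" "(?P *v (?D *v (?D *v w))) $ k = 0"
      using w by (simp_all add: invariant)
    then have "frob_cols (vector [1, t, t\<^sup>2]) *v x = 0"
      by (simp add: vec_eq_iff forall_3 matrix_vector_mult_def sum_3 x_def power2_eq_square mult_ac)
    then have "x = 0"
      using kernel invertible_power_frame[OF t] by blast
    then show ?thesis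
      using k by (simp add: x_def vec_eq_iff forall_3)
  qed
  then show ?thesis
    by (metis invertible_left_inverse matrix_left_invertible_ker)
qed

lemma exists_conjugate_eigenvector:
  fixes A B :: "'a::{field,finite}^3^3"
  assumes "det B \<noteq> 0" "\<And>c. det (A - mat_scale c B) \<noteq> 0"
  obtains t v where "t \<in> cubic_field" "frob t \<noteq> t" "v \<noteq> 0" "\<forall>i. v $ i \<in> cubic_field"
    "lift_mat A *v v = t *s (lift_mat B *v v)"
proof -
  obtain t where t: "t \<in> cubic_field" "frob t \<noteq> t"
    and root: "poly (pencil_poly (lift_mat A) (lift_mat B)) t = 0"
    using rootfree_cubic_root[of "pencil_poly A B"] assms degree_pencil_poly
    by (metis map_poly_pencil_poly poly_pencil_poly)
  let ?N = "lift_mat A - mat_scale t (lift_mat B)"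
  obtain u where "?N *v u = 0" "u \<noteq> 0"
    using root unfolding poly_pencil_poly
    by (metis invertible_det_nz invertible_left_inverse matrix_left_invertible_ker)
  moreover have "map_matrix (\<lambda>x. frob (frob (frob x))) ?N = ?N"
    using t(1) by (simp add: vec_eq_iff mat_scale_def)
  ultimately obtain v where v: "?N *v v = 0" "v \<noteq> 0" "\<And>i. frob (frob (frob (v $ i))) = v $ i"
    using exists_fixed_kernel_vector[of "\<lambda>x. frob (frob (frob x))" ?N u] by auto
  have "lift_mat A *v v = t *s (lift_mat B *v v)"
    using v(1) by (simp add: matrix_vector_mult_diff_rdistrib mat_scale_vector_mult)
  moreover have "\<forall>i. v $ i \<in> cubic_field"
    using v(3) by (simp add: cubic_field_def del: frob3)
  ultimately show ?thesis
    using that t v(2) by blast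
qed

lemma exists_diagonalising_frame:
  fixes A B :: "'a::{field,finite}^3^3"
  assumes sym: "transpose A = A" "transpose B = B"
    and det: "det B \<noteq> 0" "\<And>c. det (A - mat_scale c B) \<noteq> 0"
  obtains P d t where "frob_frame P" "d \<in> cubic_field" "d \<noteq> 0" "t \<in> cubic_field" "frob t \<noteq> t"
    "gram P B = sym_circulant d 0" "gram P A = sym_circulant (d * t) 0"
proof -
  obtain t v where t: "t \<in> cubic_field" "frob t \<noteq> t"
    and v: "v \<noteq> 0" "\<forall>i. v $ i \<in> cubic_field"
    and eigen: "lift_mat A *v v = t *s (lift_mat B *v v)"
    using exists_conjugate_eigenvector[OF det] .
  define P where "P = frob_cols v"
  have P: "frob_frame P"
    unfolding P_def using invertible_frob_cols_eigenvector[OF t det(1) v(1) eigen] v(2)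
    by (intro frob_frame_frob_cols) simp_all
  obtain a a' where a: "gram P A = sym_circulant a a'"
    using gram_eq_sym_circulant[OF P sym(1)] .
  obtain d d' where d: "d \<in> cubic_field" "gram P B = sym_circulant d d'"
    using gram_eq_sym_circulant[OF P sym(2)] .
  have "gram P A = gram P B ** sym_circulant t 0"
    using frob_cols_eigenvectors[OF eigen] by (simp add: gram_def P_def flip: matrix_mul_assoc)
  then have entry: "sym_circulant a a' $ i $ j = (sym_circulant d d' ** sym_circulant t 0) $ i $ j"
    for i j
    by (simp add: a d(2))
  have "d' * frob t = d' * t"
    using entry[of 1 2] entry[of 2 1] by (simp add: matrix_matrix_mult_def sum_3)
  then have "d' = 0"
    using t(2) by simp
  moreover have "a = d * t" "a' = d' * frob t"
    using entry[of 1 1] entry[of 1 2] by (simp_all add: matrix_matrix_mult_def sum_3)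
  moreover have "d \<noteq> 0"
    using det(1) d(2) \<open>d' = 0\<close> gram_eq_iff[OF invertible_frob_frame[OF P], of B 0]
    by (auto simp: sym_circulant_0 det_3)
  ultimately show ?thesis
    using that[OF P d(1) _ t] a d(2) by simp
qed

section \<open>Trace codes\<close>

lemma card_subspace_finite_field:
  fixes scale :: "'a::{field,finite} \<Rightarrow> 'b::ab_group_add \<Rightarrow> 'b"
  assumes "vector_space scale" "module.subspace scale S" "finite S"
  shows "card S = CARD('a) ^ vector_space.dim scale S"
proof -
  interpret vector_space scale
    by fact
  obtain B where B: "B \<subseteq> S" "independent B" "S \<subseteq> span B" "card B = dim S"
    using basis_exists by blast
  have fin: "finite B"
    using B(1) assms(3) by (rule finite_subset)
  have S: "span B = S"
    using B assms(2) span_minimal by blast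
  let ?f = "\<lambda>u. \<Sum>v\<in>B. scale (u v) v"
  have "inj_on ?f (B \<rightarrow>\<^sub>E UNIV)"
  proof (rule inj_onI)
    fix u w assume u: "u \<in> B \<rightarrow>\<^sub>E (UNIV :: 'a set)" and w: "w \<in> B \<rightarrow>\<^sub>E UNIV" and eq: "?f u = ?f w"
    have "(\<Sum>v\<in>B. scale (u v - w v) v) = 0"
      using eq by (simp add: scale_left_diff_distrib sum_subtractf)
    then have "u v - w v = 0" if "v \<in> B" for v
      using independentD[OF B(2) fin subset_refl, of "\<lambda>v. u v - w v"] that by blast
    then show "u = w"
      using u w by (intro PiE_ext) auto
  qed
  moreover have "?f ` (B \<rightarrow>\<^sub>E UNIV) = S"
  proof -
    have "?f u \<in> ?f ` (B \<rightarrow>\<^sub>E UNIV)" for u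
      by (rule image_eqI[of _ _ "restrict u B"]) auto
    then show ?thesis
      unfolding S[symmetric] span_finite[OF fin] by auto
  qed
  ultimately have "card S = card (B \<rightarrow>\<^sub>E (UNIV :: 'a set))"
    using card_image by fastforce
  then show ?thesis
    by (simp add: card_PiE fin B(4))
qed

lemma rank_eq_CARD_iff: "rank A = CARD('n) \<longleftrightarrow> det A \<noteq> 0" for A :: "'a::field^'n^'n"
proof -
  have "rank A = CARD('n) \<longleftrightarrow> vec.span (rows A) = UNIV"
    unfolding row_rank_def_gen vec.dim_eq_full[symmetric]
    by (simp add: vec.dimension_def card_cart_basis)
  also have "\<dots> \<longleftrightarrow> invertible A"
    by (simp only: matrix_left_invertible_span_rows_gen[symmetric] invertible_left_inverse)
  finally show ?thesis
    by (simp only: invertible_det_nz)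
qed

lemma perfect_msrd_codes_iff:
  fixes C :: "('a::{field,finite}^3^3) set"
  shows "C \<in> perfect_msrd_codes \<longleftrightarrow> matvs.subspace C \<and> (\<forall>M\<in>C. transpose M = M) \<and>
    (\<forall>M\<in>C. M \<noteq> 0 \<longrightarrow> det M \<noteq> 0) \<and> card C = CARD('a) ^ 3"
proof -
  have "rank M = 3 \<longleftrightarrow> det M \<noteq> 0" for M :: "'a^3^3"
    using rank_eq_CARD_iff[of M] by simp
  moreover have "matvs.dim C = 3 \<longleftrightarrow> card C = CARD('a) ^ 3" if "matvs.subspace C"
    using card_subspace_finite_field[OF matvs.vector_space_axioms that]
      CARD_field_ge_2[where 'a = 'a] by simp
  ultimately show ?thesis
    by (auto simp: perfect_msrd_codes_def linear_srd_code_def)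
qed

text \<open>
  For \<open>e = 0\<close> this is the field code; for \<open>e = 1 / 2\<close> it is the code of a twisted field. By
  \<open>det_trace_circulant\<close> these are the two values of \<open>e\<close> that give nonsingular codes.
\<close>

definition trace_code :: "'a::{field,finite} alg_closure^3^3 \<Rightarrow> 'a \<Rightarrow> ('a^3^3) set" where
  "trace_code P e =
    {M. transpose M = M \<and> (\<exists>a\<in>cubic_field. gram P M = sym_circulant a (to_ac e * Tr a))}"

lemma exists_in_trace_code:
  assumes "frob_frame P" "a \<in> cubic_field"
  obtains M where "M \<in> trace_code P e" "gram P M = sym_circulant a (to_ac e * Tr a)"
proof -
  have "to_ac e * Tr a \<in> cubic_field"
    using assms(2) by (simp add: Tr_def)
  then obtain M where "transpose M = M" "gram P M = sym_circulant a (to_ac e * Tr a)"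
    using exists_gram_eq_sym_circulant[OF assms] by blast
  then show ?thesis
    using that assms(2) by (auto simp: trace_code_def)
qed

lemma subspace_trace_code: "matvs.subspace (trace_code P e)"
proof (rule matvs.subspaceI)
  show "0 \<in> trace_code P e"
    unfolding trace_code_def
    by (auto simp: transpose_0 sym_circulant_0 intro!: bexI[of _ 0])
next
  fix M N assume "M \<in> trace_code P e" "N \<in> trace_code P e"
  then obtain a b where "a \<in> cubic_field" "gram P M = sym_circulant a (to_ac e * Tr a)"
    "b \<in> cubic_field" "gram P N = sym_circulant b (to_ac e * Tr b)"
    and "transpose M = M" "transpose N = N"
    by (auto simp: trace_code_def)
  then show "M + N \<in> trace_code P e"
    unfolding trace_code_def
    by (auto simp: transpose_add_mat gram_add Tr_add distrib_left sym_circulant_add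
        intro!: bexI[of _ "a + b"])
next
  fix c M assume "M \<in> trace_code P e"
  then obtain a where "a \<in> cubic_field" "gram P M = sym_circulant a (to_ac e * Tr a)"
    and "transpose M = M"
    by (auto simp: trace_code_def)
  then show "mat_scale c M \<in> trace_code P e"
    unfolding trace_code_def
    by (auto simp: transpose_mat_scale gram_scale Tr_mult_fixed mult.left_commute
        simp flip: sym_circulant_scale intro!: bexI[of _ "to_ac c * a"])
qed

lemma card_trace_code:
  fixes P :: "'a::{field,finite} alg_closure^3^3"
  assumes P: "frob_frame P"
  shows "card (trace_code P e) = CARD('a) ^ 3"
proof -
  have "bij_betw (\<lambda>M. gram P M $ 1 $ 1) (trace_code P e) cubic_field"
  proof (rule bij_betw_imageI)
    show "inj_on (\<lambda>M. gram P M $ 1 $ 1) (trace_code P e)"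
    proof (rule inj_onI)
      fix M N assume "M \<in> trace_code P e" "N \<in> trace_code P e" "gram P M $ 1 $ 1 = gram P N $ 1 $ 1"
      then have "gram P M = gram P N"
        by (auto simp: trace_code_def)
      then show "M = N"
        by (simp only: gram_eq_iff[OF invertible_frob_frame[OF P]])
    qed
    show "(\<lambda>M. gram P M $ 1 $ 1) ` trace_code P e = cubic_field"
    proof
      show "cubic_field \<subseteq> (\<lambda>M. gram P M $ 1 $ 1) ` trace_code P e"
      proof
        fix a :: "'a alg_closure" assume "a \<in> cubic_field"
        then obtain M where "M \<in> trace_code P e" "gram P M = sym_circulant a (to_ac e * Tr a)"
          using exists_in_trace_code[OF P] by blast
        then show "a \<in> (\<lambda>M. gram P M $ 1 $ 1) ` trace_code P e"
          by (intro image_eqI[of _ _ M]) simp_all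
      qed
    qed (auto simp: trace_code_def)
  qed
  then show ?thesis
    by (simp add: bij_betw_same_card card_cubic_field)
qed

lemma det_sym_circulant_fixed:
  "frob b = b \<Longrightarrow> det (sym_circulant a b) = Nm a + b\<^sup>2 * (2 * b - Tr a)"
  by (simp add: det_sym_circulant Nm_def Tr_def algebra_simps power2_eq_square)

lemma det_trace_circulant:
  assumes "a \<in> cubic_field" "e * (2 * e - 1) = 0"
  shows "det (sym_circulant a (to_ac e * Tr a)) = Nm a"
proof -
  have "to_ac e * (2 * to_ac e - 1) = 0"
    using arg_cong[OF assms(2), of to_ac] by simp
  then have "(to_ac e * Tr a)\<^sup>2 * (2 * (to_ac e * Tr a) - Tr a) = 0"
    by auto
  moreover have "frob (to_ac e * Tr a) = to_ac e * Tr a"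
    using assms(1) by simp
  ultimately show ?thesis
    by (simp only: det_sym_circulant_fixed add_0_right)
qed

lemma trace_code_perfect:
  assumes P: "frob_frame P" and e: "e * (2 * e - 1) = 0"
  shows "trace_code P e \<in> perfect_msrd_codes"
proof -
  have "det M \<noteq> 0" if M: "M \<in> trace_code P e" "M \<noteq> 0" for M
  proof -
    obtain a where a: "a \<in> cubic_field" "gram P M = sym_circulant a (to_ac e * Tr a)"
      using M(1) by (auto simp: trace_code_def)
    have "gram P M \<noteq> gram P 0"
      using M(2) gram_eq_iff[OF invertible_frob_frame[OF P], of M 0] by simp
    then have "a \<noteq> 0"
      by (auto simp: a(2) sym_circulant_0)
    then have "det (gram P M) \<noteq> 0"
      by (simp add: a det_trace_circulant e)
    then show ?thesis
      by (auto simp: det_gram)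
  qed
  then show ?thesis
    using subspace_trace_code[of P e] card_trace_code[OF P, of e]
    by (auto simp: perfect_msrd_codes_iff trace_code_def)
qed

lemma code_equivalent_trace_code:
  fixes P Q :: "'a::{field,finite} alg_closure^3^3"
  assumes P: "frob_frame P" and Q: "frob_frame Q"
  shows "code_equivalent (trace_code P e) (trace_code Q e)"
proof -
  obtain A where A: "invertible A" "P = lift_mat A ** Q"
    using frob_frames_related[OF assms] .
  let ?f = "\<lambda>M. transpose A ** M ** A"
  have gram: "gram P M = gram Q (?f M)" for M
    by (simp add: A(2) gram_lift_mult)
  have "inj ?f"
    by (intro injI) (metis P gram gram_eq_iff invertible_frob_frame)
  then have "card (?f ` trace_code P e) = card (trace_code Q e)"
    by (simp add: card_image inj_on_subset card_trace_code P Q)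
  moreover have "?f ` trace_code P e \<subseteq> trace_code Q e"
    by (auto simp: trace_code_def gram matrix_transpose_mul matrix_mul_assoc)
  ultimately have "?f ` trace_code P e = trace_code Q e"
    by (intro card_subset_eq) auto
  then have "trace_code Q e = {transpose A ** M ** A | M. M \<in> trace_code P e}"
    by blast
  moreover have "invertible (transpose A)"
    using A(1) by (simp add: invertible_det_nz)
  ultimately show ?thesis
    using A(1) unfolding code_equivalent_def by blast
qed

section \<open>Commuting quotients\<close>

text \<open>
  The condition is \<open>(U Y\<inverse>) (Z Y\<inverse>) = (Z Y\<inverse>) (U Y\<inverse>)\<close>, multiplied by \<open>Y\<close> on the right.
\<close>

definition quotients_commute :: "('a::field^'n^'n) set \<Rightarrow> bool" where
  "quotients_commute C \<longleftrightarrow>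
    (\<forall>U\<in>C. \<forall>Y\<in>C. \<forall>Z\<in>C. \<forall>R. Y ** R = mat 1 \<longrightarrow> U ** R ** Z = Z ** R ** U)"

lemma quotients_commute_code_equivalent:
  assumes "code_equivalent C C'" "quotients_commute C"
  shows "quotients_commute C'"
proof -
  obtain A B where A: "invertible A" and C': "C' = {A ** M ** B | M. M \<in> C}"
    using assms(1) unfolding code_equivalent_def by blast
  obtain A' where A': "A' ** A = mat 1"
    using A unfolding invertible_def by blast
  have "A ** U ** B ** R ** (A ** Z ** B) = A ** Z ** B ** R ** (A ** U ** B)"
    if UYZ: "U \<in> C" "Y \<in> C" "Z \<in> C" and R: "A ** Y ** B ** R = mat 1" for U Y Z R
  proof -
    have "Y ** (B ** R ** A) = A' ** (A ** Y ** B ** R) ** A"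
      by (simp add: A' matrix_mul_assoc)
    also have "\<dots> = mat 1"
      by (simp add: A' R)
    finally have "U ** (B ** R ** A) ** Z = Z ** (B ** R ** A) ** U"
      using assms(2) UYZ unfolding quotients_commute_def by blast
    then have "A ** (U ** (B ** R ** A) ** Z) ** B = A ** (Z ** (B ** R ** A) ** U) ** B"
      by simp
    then show ?thesis
      by (simp only: matrix_mul_assoc)
  qed
  then show ?thesis
    unfolding quotients_commute_def C' by blast
qed

lemma gram_quotient:
  assumes P: "invertible P" and YR: "Y ** R = mat 1" and YG: "gram P Y ** G = mat 1"
  shows "gram P (U ** R ** Z) = gram P U ** G ** gram P Z"
proof -
  obtain Q where Q: "P ** Q = mat 1"
    using P unfolding invertible_def by blast
  let ?G = "P ** G ** transpose P"
  have "lift_mat Y ** ?G = transpose (P ** Q) ** lift_mat Y ** ?G"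
    by (simp add: Q)
  also have "\<dots> = transpose Q ** (gram P Y ** G) ** transpose P"
    by (simp add: gram_def matrix_transpose_mul matrix_mul_assoc)
  also have "\<dots> = transpose (P ** Q)"
    by (simp add: YG matrix_transpose_mul)
  finally have "lift_mat R ** (lift_mat Y ** ?G) = lift_mat R"
    by (simp add: Q)
  moreover have "lift_mat R ** lift_mat Y = mat 1"
    by (metis YR lift_mat_1 lift_mat_mult matrix_left_right_inverse)
  ultimately have "?G = lift_mat R"
    by (simp add: matrix_mul_assoc)
  then have "gram P (U ** R ** Z) = transpose P ** lift_mat U ** ?G ** lift_mat Z ** P"
    by (simp add: gram_def lift_mat_mult matrix_mul_assoc)
  then show ?thesis
    by (simp add: gram_def matrix_mul_assoc)
qed

lemma invertible_if_gram_invertible: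
  fixes P :: "'a::field alg_closure^3^3"
  assumes "gram P Y ** G = mat 1"
  obtains R where "Y ** R = mat 1"
proof -
  have "det (gram P Y) * det G = 1"
    by (metis assms det_mul det_I)
  then have "det Y \<noteq> 0"
    by (auto simp: det_gram)
  then show ?thesis
    using that unfolding invertible_det_nz[symmetric] invertible_def by blast
qed

lemma quotients_commute_iff_gram:
  fixes P :: "'a::field alg_closure^3^3"
  assumes P: "invertible P"
  shows "quotients_commute C \<longleftrightarrow> (\<forall>U\<in>C. \<forall>Y\<in>C. \<forall>Z\<in>C. \<forall>G. gram P Y ** G = mat 1 \<longrightarrow>
    gram P U ** G ** gram P Z = gram P Z ** G ** gram P U)" (is "_ \<longleftrightarrow> ?gram")
proof
  assume commute: "quotients_commute C"
  show ?gram
  proof (intro ballI allI impI)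
    fix U Y Z G assume codewords: "U \<in> C" "Y \<in> C" "Z \<in> C" and G: "gram P Y ** G = mat 1"
    obtain R where R: "Y ** R = mat 1"
      using invertible_if_gram_invertible[OF G] .
    then have "U ** R ** Z = Z ** R ** U"
      using commute codewords unfolding quotients_commute_def by blast
    then show "gram P U ** G ** gram P Z = gram P Z ** G ** gram P U"
      using gram_quotient[OF P R G] by metis
  qed
next
  assume gram: ?gram
  show "quotients_commute C"
    unfolding quotients_commute_def
  proof (intro ballI allI impI)
    fix U Y Z R assume codewords: "U \<in> C" "Y \<in> C" "Z \<in> C" and R: "Y ** R = mat 1"
    have "det Y * det R = 1"
      by (metis R det_mul det_I)
    then have "invertible (gram P Y)"
      using P by (auto simp: det_gram invertible_det_nz)
    then obtain G where G: "gram P Y ** G = mat 1"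
      unfolding invertible_def by blast
    then have "gram P (U ** R ** Z) = gram P (Z ** R ** U)"
      using gram codewords by (simp add: gram_quotient[OF P R G])
    then show "U ** R ** Z = Z ** R ** U"
      by (simp add: gram_eq_iff[OF P])
  qed
qed

lemma sym_circulant_inverse_diag:
  assumes "a \<noteq> 0"
  shows "sym_circulant a 0 ** G = mat 1 \<longleftrightarrow> G = sym_circulant (1 / a) 0"
proof
  assume "sym_circulant a 0 ** G = mat 1"
  then have "sym_circulant (1 / a) 0 ** sym_circulant a 0 ** G = sym_circulant (1 / a) 0"
    by (simp flip: matrix_mul_assoc)
  then show "G = sym_circulant (1 / a) 0"
    using assms by (simp add: sym_circulant_mult_diag sym_circulant_1)
qed (use assms in \<open>simp add: sym_circulant_mult_diag sym_circulant_1\<close>)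

lemma quotients_commute_field_code:
  assumes P: "frob_frame P"
  shows "quotients_commute (trace_code P 0)"
  unfolding quotients_commute_iff_gram[OF invertible_frob_frame[OF P]]
proof (intro ballI allI impI)
  fix U Y Z G
  assume codewords: "U \<in> trace_code P 0" "Y \<in> trace_code P 0" "Z \<in> trace_code P 0"
    and G: "gram P Y ** G = mat 1"
  obtain u y z where coords: "gram P U = sym_circulant u 0" "gram P Y = sym_circulant y 0"
    "gram P Z = sym_circulant z 0"
    using codewords by (auto simp: trace_code_def)
  have "y \<noteq> 0"
    using arg_cong[OF G, of det] by (auto simp: coords det_mul det_sym_circulant Nm_def)
  then have "G = sym_circulant (1 / y) 0"
    using G by (simp add: coords sym_circulant_inverse_diag)
  then show "gram P U ** G ** gram P Z = gram P Z ** G ** gram P U"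
    by (simp add: coords sym_circulant_mult_diag)
qed

lemma not_quotients_commute_trace_code:
  fixes P :: "'a::{field,finite} alg_closure^3^3"
  assumes P: "frob_frame P" and "e \<noteq> 0"
  shows "\<not> quotients_commute (trace_code P e)"
proof
  assume "quotients_commute (trace_code P e)"
  note commute =
    this[unfolded quotients_commute_iff_gram[OF invertible_frob_frame[OF P]], rule_format]
  obtain t :: "'a alg_closure" where t: "t \<in> cubic_field" "frob t \<noteq> t"
    by (rule exists_cubic_generator)
  obtain z :: "'a alg_closure" where z: "z \<in> cubic_field" "Tr z \<noteq> 0"
    by (rule exists_Tr_nonzero)
  let ?y = "t - frob t" and ?u = "t\<^sup>2 - (frob t)\<^sup>2" and ?b = "to_ac e * Tr z"
  have Tr_0: "Tr ?y = 0" "Tr ?u = 0" and K: "?y \<in> cubic_field" "?u \<in> cubic_field"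
    using t(1) by (simp_all add: Tr_def)
  obtain Y where Y: "Y \<in> trace_code P e" "gram P Y = sym_circulant ?y 0"
    using exists_in_trace_code[OF P K(1), of e] unfolding Tr_0 mult_zero_right .
  obtain U where U: "U \<in> trace_code P e" "gram P U = sym_circulant ?u 0"
    using exists_in_trace_code[OF P K(2), of e] unfolding Tr_0 mult_zero_right .
  obtain Z where Z: "Z \<in> trace_code P e" "gram P Z = sym_circulant z ?b"
    using exists_in_trace_code[OF P z(1)] .
  let ?G = "sym_circulant (1 / ?y) 0"
  have "gram P Y ** ?G = mat 1"
    using t(2) by (simp add: Y(2) sym_circulant_inverse_diag)
  from commute[OF U(1) Y(1) Z(1) this]
  have "gram P U ** ?G ** gram P Z = gram P Z ** (?G ** gram P U)"
    by (simp add: matrix_mul_assoc)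
  moreover have "gram P U ** ?G = sym_circulant (t + frob t) 0"
    "?G ** gram P U = sym_circulant (t + frob t) 0"
    using t(2) by (simp_all add: U(2) sym_circulant_mult_diag field_simps power2_eq_square)
  ultimately have "(sym_circulant (t + frob t) 0 ** sym_circulant z ?b) $ 1 $ 2 =
      (sym_circulant z ?b ** sym_circulant (t + frob t) 0) $ 1 $ 2"
    by (simp only: Z(2))
  then have "(t + frob t) * ?b = (frob t + frob (frob t)) * ?b"
    by (simp add: matrix_matrix_mult_def sum_3 mult.commute)
  then show False
    using \<open>e \<noteq> 0\<close> z(2) cubic_generator_distinct(1)[OF t] by simp
qed

lemma code_equivalent_trace_code_imp_eq:
  fixes e e' :: "'a::{field,finite}"
  assumes "frob_frame P" "e * (2 * e - 1) = 0" "e' * (2 * e' - 1) = 0"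
    and equiv: "code_equivalent (trace_code P e) (trace_code P e')"
  shows "e = e'"
proof -
  have "quotients_commute (trace_code P e) \<longleftrightarrow> quotients_commute (trace_code P e')"
    using quotients_commute_code_equivalent equiv code_equivalent_sym by blast
  then have "e = 0 \<longleftrightarrow> e' = 0"
    using quotients_commute_field_code not_quotients_commute_trace_code assms(1) by metis
  moreover have "2 * e = 2 * e'" if "e \<noteq> 0" "e' \<noteq> 0"
    using that assms(2,3) by simp
  moreover have "(2 :: 'a) \<noteq> 0" if "e \<noteq> 0"
    using that assms(2) by auto
  ultimately show ?thesis
    by (cases "e = 0") auto
qed

section \<open>Classification\<close>

lemma perfect_msrd_codeD:
  fixes C :: "('a::{field,finite}^3^3) set"
  assumes "C \<in> perfect_msrd_codes"
  shows "matvs.subspace C" "card C = CARD('a) ^ 3" "M \<in> C \<Longrightarrow> transpose M = M"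
    "M \<in> C \<Longrightarrow> M \<noteq> 0 \<Longrightarrow> det M \<noteq> 0"
  using assms by (auto simp: perfect_msrd_codes_iff)

lemma exists_nonsingular_pencil:
  fixes C :: "('a::{field,finite}^3^3) set"
  assumes C: "C \<in> perfect_msrd_codes"
  obtains A B where "A \<in> C" "B \<in> C" "det B \<noteq> 0" "\<forall>c. det (A - mat_scale c B) \<noteq> 0"
proof -
  note sub = perfect_msrd_codeD(1)[OF C]
  have not_line: "\<not> C \<subseteq> range (\<lambda>c. mat_scale c M)" for M
  proof
    assume "C \<subseteq> range (\<lambda>c. mat_scale c M)"
    then have "card C \<le> CARD('a)"
      using card_mono[of "range (\<lambda>c. mat_scale c M)" C]
        card_image_le[of "UNIV :: 'a set" "\<lambda>c. mat_scale c M"] by simp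
    then show False
      using perfect_msrd_codeD(2)[OF C] CARD_field_ge_2[where 'a = 'a]
        power_strict_increasing[of 1 3 "CARD('a)"] by simp
  qed
  obtain B where B: "B \<in> C" "B \<noteq> 0"
    using not_line[of 0] by (auto simp: matvs.scale_zero_right)
  obtain A where A: "A \<in> C" "A \<notin> range (\<lambda>c. mat_scale c B)"
    using not_line[of B] by blast
  have "A - mat_scale c B \<in> C" for c
    by (rule matvs.subspace_diff[OF sub A(1) matvs.subspace_scale[OF sub B(1)]])
  moreover have "A - mat_scale c B \<noteq> 0" for c
    using A(2) by auto
  ultimately show ?thesis
    using that[OF A(1) B(1)] perfect_msrd_codeD(4)[OF C] B by blast
qed

definition gram_coords :: "'a::{field,finite} alg_closure^3^3 \<Rightarrow> ('a^3^3) set \<Rightarrow>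
    ('a alg_closure \<times> 'a alg_closure) set" where
  "gram_coords P C = {(a, b). \<exists>M\<in>C. gram P M = sym_circulant a b}"

lemma gram_coordsI: "M \<in> C \<Longrightarrow> gram P M = sym_circulant a b \<Longrightarrow> (a, b) \<in> gram_coords P C"
  by (auto simp: gram_coords_def)

lemma gram_coords_add:
  assumes "matvs.subspace C" "(a, b) \<in> gram_coords P C" "(c, d) \<in> gram_coords P C"
  shows "(a + c, b + d) \<in> gram_coords P C"
proof -
  obtain M N where MN: "M \<in> C" "N \<in> C" "gram P M = sym_circulant a b" "gram P N = sym_circulant c d"
    using assms(2,3) by (auto simp: gram_coords_def)
  then show ?thesis
    using matvs.subspace_add[OF assms(1)]
    by (intro gram_coordsI[of "M + N"]) (simp_all add: gram_add sym_circulant_add)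
qed

lemma gram_coords_scale:
  assumes "matvs.subspace C" "(a, b) \<in> gram_coords P C"
  shows "(to_ac r * a, to_ac r * b) \<in> gram_coords P C"
proof -
  obtain M where "M \<in> C" "gram P M = sym_circulant a b"
    using assms(2) by (auto simp: gram_coords_def)
  then show ?thesis
    using matvs.subspace_scale[OF assms(1)]
    by (intro gram_coordsI[of "mat_scale r M"]) (simp_all add: gram_scale sym_circulant_scale)
qed

lemma gram_coords_diff:
  assumes "matvs.subspace C" "(a, b) \<in> gram_coords P C" "(c, d) \<in> gram_coords P C"
  shows "(a - c, b - d) \<in> gram_coords P C"
  using gram_coords_add[OF assms(1,2) gram_coords_scale[OF assms(1,3), of "- 1"]] by simp

lemma gram_coords_nonsingular:
  assumes C: "C \<in> perfect_msrd_codes" and P: "frob_frame P"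
    and ab: "(a, b) \<in> gram_coords P C" "(a, b) \<noteq> (0, 0)"
  shows "det (sym_circulant a b) \<noteq> 0"
proof -
  obtain M where M: "M \<in> C" "gram P M = sym_circulant a b"
    using ab(1) by (auto simp: gram_coords_def)
  then have "M \<noteq> 0"
    using ab(2) by (auto simp flip: sym_circulant_0)
  then have "det M \<noteq> 0"
    using perfect_msrd_codeD(4)[OF C M(1)] by blast
  then show ?thesis
    using invertible_frob_frame[OF P] by (simp add: det_gram invertible_det_nz flip: M(2))
qed

lemma trace_code_eqI:
  assumes C: "C \<in> perfect_msrd_codes" and P: "frob_frame P"
    and coords: "\<And>a. a \<in> cubic_field \<Longrightarrow> (a, to_ac e * Tr a) \<in> gram_coords P C"
  shows "C = trace_code P e"
proof -
  have "trace_code P e \<subseteq> C"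
  proof
    fix M assume "M \<in> trace_code P e"
    then obtain a where "a \<in> cubic_field" "gram P M = sym_circulant a (to_ac e * Tr a)"
      by (auto simp: trace_code_def)
    then obtain N where "N \<in> C" "gram P M = gram P N"
      using coords[of a] by (auto simp: gram_coords_def)
    then show "M \<in> C"
      by (simp add: gram_eq_iff[OF invertible_frob_frame[OF P]])
  qed
  then show ?thesis
    using card_subset_eq[of C "trace_code P e"] perfect_msrd_codeD(2)[OF C] card_trace_code[OF P]
    by simp
qed

lemma exists_trace_annihilator:
  fixes d t :: "'a::{field,finite} alg_closure"
  assumes d: "d \<in> cubic_field" "d \<noteq> 0" and t: "t \<in> cubic_field" "frob t \<noteq> t"
  obtains c where "c \<in> cubic_field" "c \<noteq> 0"
    "\<forall>x\<in>cubic_field. Tr (c * x) = 0 \<longrightarrow> (\<exists>r s. x = to_ac r * d + to_ac s * (d * t))"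
proof
  let ?c = "frob d * frob (frob d) * (frob (frob t) - frob t)"
  show "?c \<in> cubic_field" "?c \<noteq> 0"
    using d t cubic_generator_distinct[OF t] by simp_all
  show "\<forall>x\<in>cubic_field. Tr (?c * x) = 0 \<longrightarrow> (\<exists>r s. x = to_ac r * d + to_ac s * (d * t))"
  proof (intro ballI impI)
    fix x assume x: "x \<in> cubic_field" "Tr (?c * x) = 0"
    define y where "y = x / d"
    have "Tr (?c * x) = Nm d *
        ((frob y - frob (frob y)) * (t - frob t) - (y - frob y) * (frob t - frob (frob t)))"
      using d t(1) by (simp add: y_def Tr_def Nm_def field_simps)
    then have proportional:
      "(frob y - frob (frob y)) * (t - frob t) = (y - frob y) * (frob t - frob (frob t))"
      using x(2) d(2) by simp
    define s where "s = (y - frob y) / (t - frob t)"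
    have "t - frob t \<noteq> 0" "frob t - frob (frob t) \<noteq> 0"
      using t(2) by auto
    then have "frob s = s"
      using proportional by (simp add: s_def frac_eq_eq)
    moreover have "s * (t - frob t) = y - frob y"
      using t(2) by (simp add: s_def)
    then have "frob (y - s * t) = y - s * t"
      using \<open>frob s = s\<close> by (simp add: algebra_simps)
    ultimately obtain r0 s0 where "y - s * t = to_ac r0" "s = to_ac s0"
      using frob_fixed_iff by (metis imageE)
    then have "y = to_ac r0 + to_ac s0 * t"
      by (simp add: algebra_simps)
    then have "x = to_ac r0 * d + to_ac s0 * (d * t)"
      using d(2) by (simp add: y_def field_simps)
    then show "\<exists>r s. x = to_ac r * d + to_ac s * (d * t)"
      by blast
  qed
qed

text \<open>
  The codewords with coordinates \<open>(1 + w, 1)\<close> have determinant \<open>Nm w * (1 + Tr (1 / w))\<close>, which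
  vanishes for \<open>w = - Tr v / v\<close>.
\<close>

lemma singular_circulant_if_trace_norm:
  assumes v: "v \<in> cubic_field" "v \<noteq> 0" and eq: "Tr v * Tr (c * frob v * frob (frob v)) = m * Nm v"
  defines "w \<equiv> - Tr v / v"
  shows "w \<in> cubic_field" "Tr (c * w) = - m" "det (sym_circulant (1 + w) 1) = 0"
proof -
  show "w \<in> cubic_field"
    using v(1) by (simp add: w_def Tr_def)
  have products: "w * v = - Tr v" "frob w * frob v = - Tr v"
    "frob (frob w) * frob (frob v) = - Tr v"
    using v by (simp_all add: w_def)
  have "Tr (c * w) * Nm v = c * (w * v) * (frob v * frob (frob v))
      + frob c * (frob w * frob v) * (frob (frob v) * v)
      + frob (frob c) * (frob (frob w) * frob (frob v)) * (v * frob v)"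
    by (simp add: Tr_def[of "c * w"] Nm_def algebra_simps)
  also have "\<dots> = - (Tr v * Tr (c * frob v * frob (frob v)))"
    unfolding products Tr_def[of "c * frob v * frob (frob v)"] using v(1)
    by (simp add: algebra_simps)
  finally have "Tr (c * w) * Nm v = - m * Nm v"
    by (simp add: eq)
  then show "Tr (c * w) = - m"
    using v(2) by (metis Nm_eq_0_iff mult_right_cancel)
  have "det (sym_circulant (1 + w) 1) * Nm v = (w * v) * (frob w * frob v) * frob (frob v)
      + (frob w * frob v) * (frob (frob w) * frob (frob v)) * v
      + (frob (frob w) * frob (frob v)) * (w * v) * frob v
      + (w * v) * (frob w * frob v) * (frob (frob w) * frob (frob v))"
    by (simp add: det_sym_circulant Nm_def algebra_simps)
  also have "\<dots> = (Tr v)\<^sup>2 * (v + frob v + frob (frob v) - Tr v)"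
    unfolding products by (simp add: algebra_simps power2_eq_square)
  also have "\<dots> = 0"
    by (simp add: Tr_def)
  finally show "det (sym_circulant (1 + w) 1) = 0"
    using v(2) by simp
qed

locale normalised_code =
  fixes C :: "('a::{field,finite}^3^3) set" and P a c
  assumes q: "2 < CARD('a)" and C: "C \<in> perfect_msrd_codes" and P: "frob_frame P"
    and a: "(a, 1) \<in> gram_coords P C" "a \<in> cubic_field" and c: "c \<in> cubic_field" "c \<noteq> 0"
    and hyperplane: "\<forall>x\<in>cubic_field. Tr (c * x) = 0 \<longrightarrow> (x, 0) \<in> gram_coords P C"
begin

lemmas subspace = perfect_msrd_codeD(1)[OF C]

lemma det_shifted_circulant:
  assumes "w \<in> cubic_field" "Tr (c * w) = Tr (c * (a - 1))"
  shows "det (sym_circulant (1 + w) 1) \<noteq> 0"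
proof -
  have "Tr (c * (a - 1 - w)) = 0"
    using assms(2) by (simp add: right_diff_distrib Tr_diff)
  then have "(a - 1 - w, 0) \<in> gram_coords P C"
    using a(2) assms(1) by (intro hyperplane[rule_format]) simp_all
  from gram_coords_diff[OF subspace a(1) this]
  have "(1 + w, 1) \<in> gram_coords P C"
    by simp
  then show ?thesis
    using gram_coords_nonsingular[OF C P] by simp
qed

lemma annihilator_in_base: "frob c = c" "Tr (c * (a - 1)) = - c"
proof -
  let ?m = "- Tr (c * (a - 1))"
  have "frob c = c \<and> ?m = c"
  proof (rule ccontr)
    assume "\<not> (frob c = c \<and> ?m = c)"
    moreover have "frob ?m = ?m"
      using a(2) c(1) by simp
    ultimately obtain v where v: "v \<in> cubic_field" "v \<noteq> 0"
      "Tr v * Tr (c * frob v * frob (frob v)) = ?m * Nm v"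
      using exists_trace_norm_solution[OF q c] by blast
    note singular = singular_circulant_if_trace_norm[OF v]
    show False
      using det_shifted_circulant[OF singular(1)] singular(2,3) unfolding minus_minus by blast
  qed
  then show "frob c = c" "Tr (c * (a - 1)) = - c"
    by (simp, metis minus_minus)
qed

lemma Tr_eq_2: "Tr a = 2"
proof -
  have "c * (Tr a - 3) = c * (- 1)"
    using annihilator_in_base(2)
    by (simp add: Tr_mult_fixed[OF annihilator_in_base(1)] Tr_diff Tr_1)
  then show ?thesis
    using c(2) by (simp add: algebra_simps)
qed

lemma trace_hyperplane: "x \<in> cubic_field \<Longrightarrow> Tr x = 0 \<Longrightarrow> (x, 0) \<in> gram_coords P C"
  by (rule hyperplane[rule_format]) (simp_all add: Tr_mult_fixed[OF annihilator_in_base(1)])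

lemma two_nonzero: "(2 :: 'a) \<noteq> 0"
proof
  assume "(2 :: 'a) = 0"
  then have two: "(2 :: 'a alg_closure) = 0"
    by (metis to_ac_0 to_ac_numeral)
  then have "(a, 0) \<in> gram_coords P C"
    using trace_hyperplane[OF a(2)] Tr_eq_2 by simp
  from gram_coords_diff[OF subspace a(1) this]
  have "det (sym_circulant 0 (1 :: 'a alg_closure)) \<noteq> 0"
    using gram_coords_nonsingular[OF C P] by simp
  then show False
    by (simp add: det_sym_circulant Nm_def two)
qed

lemma eq_twisted_field_code: "C = trace_code P (1 / 2)"
proof (rule trace_code_eqI[OF C P])
  fix x :: "'a alg_closure" assume x: "x \<in> cubic_field"
  obtain r where r: "Tr x = to_ac r"
    using Tr_in_base[OF x] .
  let ?h = "to_ac (r / 2)"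
  have "Tr (?h * a) = to_ac (r / 2 * 2)"
    unfolding Tr_mult_fixed[OF frob_to_ac] Tr_eq_2 by (simp only: to_ac_mult to_ac_numeral)
  then have "Tr (x - ?h * a) = 0"
    using two_nonzero by (simp add: Tr_diff r)
  then have "(x - ?h * a, 0) \<in> gram_coords P C"
    using x a(2) by (intro trace_hyperplane) simp_all
  from gram_coords_add[OF subspace this gram_coords_scale[OF subspace a(1), of "r / 2"]]
  show "(x, to_ac (1 / 2) * Tr x) \<in> gram_coords P C"
    by (simp add: r mult.commute)
qed

end

lemma exists_normalised_frame:
  fixes C :: "('a::{field,finite}^3^3) set"
  assumes sub: "matvs.subspace C" and P: "frob_frame P"
    and ab: "(a, b) \<in> gram_coords P C" "a \<in> cubic_field" "b \<in> cubic_field" "b \<noteq> 0"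
  obtains Q s a' where "frob_frame Q" "s \<in> cubic_field" "s \<noteq> 0"
    "(a', 1) \<in> gram_coords Q C" "a' \<in> cubic_field"
    "\<forall>x. (x, 0) \<in> gram_coords P C \<longrightarrow> (s * x, 0) \<in> gram_coords Q C"
proof -
  let ?S = "sym_circulant (frob b) 0" and ?s = "(frob b)\<^sup>2"
  have "det ?S \<noteq> 0"
    using ab(4) by (simp add: det_sym_circulant Nm_def)
  then have Q: "frob_frame (P ** ?S)"
    using ab(3) by (intro frob_frame_mult_circulant P frob_circulant_sym_circulant)
      (simp_all add: invertible_det_nz)
  have rescale: "(?s * x, frob b * frob (frob b) * y) \<in> gram_coords (P ** ?S) C"
    if xy: "(x, y) \<in> gram_coords P C" for x y
  proof -
    obtain M where M: "M \<in> C" "gram P M = sym_circulant x y"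
      using xy by (auto simp: gram_coords_def)
    then show ?thesis
      using ab(3) sym_circulant_congruence_diag[of "frob b" x y]
      by (intro gram_coordsI[OF M(1)]) (simp add: gram_mult)
  qed
  have "frob (Nm b) = Nm b"
    using ab(3) by simp
  then obtain n where n: "Nm b = to_ac n"
    using frob_fixed_iff by blast
  have n0: "n \<noteq> 0"
    using ab(4) n by auto
  have "(?s * a, Nm b) \<in> gram_coords (P ** ?S) C"
    using rescale[OF ab(1)] by (simp add: Nm_def mult_ac)
  from gram_coords_scale[OF sub this, of "1 / n"]
  have "(to_ac (1 / n) * (?s * a), 1) \<in> gram_coords (P ** ?S) C"
    using n0 by (simp add: n)
  then show ?thesis
    using that[OF Q, of ?s "to_ac (1 / n) * (?s * a)"] rescale[of _ 0] ab by simp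
qed

lemma eq_field_code_if_diagonal:
  assumes C: "C \<in> perfect_msrd_codes" and P: "frob_frame P"
    and diagonal: "\<And>a b. (a, b) \<in> gram_coords P C \<Longrightarrow> b = 0"
  shows "C = trace_code P 0"
proof -
  have "C \<subseteq> trace_code P 0"
  proof
    fix M assume M: "M \<in> C"
    then have sym: "transpose M = M"
      by (rule perfect_msrd_codeD(3)[OF C])
    obtain a b where ab: "a \<in> cubic_field" "b \<in> cubic_field" "gram P M = sym_circulant a b"
      using gram_eq_sym_circulant[OF P sym] .
    moreover have "b = 0"
      using diagonal[OF gram_coordsI[OF M ab(3)]] .
    ultimately show "M \<in> trace_code P 0"
      unfolding trace_code_def using sym by (intro CollectI conjI bexI[of _ a]) simp_all
  qed
  then show ?thesis
    using card_subset_eq[of "trace_code P 0" C] perfect_msrd_codeD(2)[OF C] card_trace_code[OF P]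
    by simp
qed

lemma eq_twisted_field_code_if_not_diagonal:
  fixes C :: "('a::{field,finite}^3^3) set"
  assumes q: "2 < CARD('a)" and C: "C \<in> perfect_msrd_codes" and P: "frob_frame P"
    and d: "d \<in> cubic_field" "d \<noteq> 0" and t: "t \<in> cubic_field" "frob t \<noteq> t"
    and pencil: "(d, 0) \<in> gram_coords P C" "(d * t, 0) \<in> gram_coords P C"
    and ab: "(a, b) \<in> gram_coords P C" "a \<in> cubic_field" "b \<in> cubic_field" "b \<noteq> 0"
  obtains Q where "frob_frame Q" "C = trace_code Q (1 / 2)" "(2 :: 'a) \<noteq> 0"
proof -
  note sub = perfect_msrd_codeD(1)[OF C]
  obtain Q s a' where Q: "frob_frame Q" and s: "s \<in> cubic_field" "s \<noteq> 0"
    and a': "(a', 1) \<in> gram_coords Q C" "a' \<in> cubic_field"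
    and rescale: "\<forall>x. (x, 0) \<in> gram_coords P C \<longrightarrow> (s * x, 0) \<in> gram_coords Q C"
    using exists_normalised_frame[OF sub P ab] .
  have sd: "s * d \<in> cubic_field" "s * d \<noteq> 0"
    using s d by simp_all
  obtain c where c: "c \<in> cubic_field" "c \<noteq> 0"
    and span: "\<forall>x\<in>cubic_field. Tr (c * x) = 0 \<longrightarrow>
      (\<exists>r u. x = to_ac r * (s * d) + to_ac u * (s * d * t))"
    using exists_trace_annihilator[OF sd t] .
  have "(s * d, 0) \<in> gram_coords Q C" "(s * d * t, 0) \<in> gram_coords Q C"
    using rescale pencil by (simp_all add: mult.assoc)
  then have "(to_ac r * (s * d) + to_ac u * (s * d * t), to_ac r * 0 + to_ac u * 0)
      \<in> gram_coords Q C" for r u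
    by (intro gram_coords_add gram_coords_scale sub)
  then have "\<forall>x\<in>cubic_field. Tr (c * x) = 0 \<longrightarrow> (x, 0) \<in> gram_coords Q C"
    using span by (metis add_0_right mult_zero_right)
  then interpret normalised_code C Q a' c
    using q C Q a' c by unfold_locales
  show ?thesis
    using that[OF Q eq_twisted_field_code two_nonzero] .
qed

theorem perfect_msrd_code_classification:
  fixes C :: "('a::{field,finite}^3^3) set"
  assumes q: "2 < CARD('a)" and C: "C \<in> perfect_msrd_codes"
  obtains P e where "frob_frame P" "e * (2 * e - 1) = 0" "C = trace_code P e"
proof -
  note sym = perfect_msrd_codeD(3)[OF C]
  obtain A B where AB: "A \<in> C" "B \<in> C" "det B \<noteq> 0" "\<forall>c. det (A - mat_scale c B) \<noteq> 0"
    using exists_nonsingular_pencil[OF C] .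
  obtain P d t where P: "frob_frame P" and d: "d \<in> cubic_field" "d \<noteq> 0"
    and t: "t \<in> cubic_field" "frob t \<noteq> t"
    and pencil: "gram P B = sym_circulant d 0" "gram P A = sym_circulant (d * t) 0"
    using exists_diagonalising_frame[OF sym[OF AB(1)] sym[OF AB(2)] AB(3) AB(4)[rule_format]] .
  show ?thesis
  proof (cases "\<forall>M\<in>C. gram P M $ 1 $ 2 = 0")
    case True
    then have "b = 0" if "(a, b) \<in> gram_coords P C" for a b
      using that by (force simp: gram_coords_def)
    then have "C = trace_code P 0"
      by (rule eq_field_code_if_diagonal[OF C P])
    then show ?thesis
      using that[OF P, of 0] by simp
  next
    case False
    then obtain M where M: "M \<in> C" "gram P M $ 1 $ 2 \<noteq> 0"
      by blast
    obtain a b where ab: "a \<in> cubic_field" "b \<in> cubic_field" "gram P M = sym_circulant a b"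
      using gram_eq_sym_circulant[OF P sym[OF M(1)]] .
    then have b: "b \<noteq> 0"
      using M(2) by simp
    obtain Q where "frob_frame Q" "C = trace_code Q (1 / 2)" "(2 :: 'a) \<noteq> 0"
      using eq_twisted_field_code_if_not_diagonal[OF q C P d t gram_coordsI[OF AB(2) pencil(1)]
          gram_coordsI[OF AB(1) pencil(2)] gram_coordsI[OF M(1) ab(3)] ab(1,2) b] .
    then show ?thesis
      using that[of Q "1 / 2"] by simp
  qed
qed

lemma inj_on_trace_code_class:
  assumes P: "frob_frame P"
  shows "inj_on (\<lambda>e. perfect_msrd_equiv `` {trace_code P e}) {e. e * (2 * e - 1) = 0}"
proof (rule inj_onI)
  fix e e' assume e: "e \<in> {e. e * (2 * e - 1) = 0}" "e' \<in> {e. e * (2 * e - 1) = 0}"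
    and eq: "perfect_msrd_equiv `` {trace_code P e} = perfect_msrd_equiv `` {trace_code P e'}"
  have "trace_code P e' \<in> perfect_msrd_codes"
    using e(2) trace_code_perfect[OF P] by blast
  then have "code_equivalent (trace_code P e) (trace_code P e')"
    using eq_equiv_class[OF eq equiv_perfect_msrd] by (simp add: perfect_msrd_equiv_def)
  then show "e = e'"
    using code_equivalent_trace_code_imp_eq[OF P] e by blast
qed

lemma perfect_msrd_quotient_eq:
  fixes P :: "'a::{field,finite} alg_closure^3^3"
  assumes "2 < CARD('a)" and P: "frob_frame P"
  shows "perfect_msrd_codes // perfect_msrd_equiv =
    (\<lambda>e. perfect_msrd_equiv `` {trace_code P e}) ` {e. e * (2 * e - 1) = 0}" (is "_ = ?classes")
proof (intro equalityI subsetI)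
  fix K assume "K \<in> ?classes"
  then obtain e where "e * (2 * e - 1) = 0" "K = perfect_msrd_equiv `` {trace_code P e}"
    by blast
  then show "K \<in> perfect_msrd_codes // perfect_msrd_equiv"
    using quotientI[OF trace_code_perfect[OF P]] by blast
next
  fix K :: "('a^3^3) set set" assume "K \<in> perfect_msrd_codes // perfect_msrd_equiv"
  then obtain C where C: "C \<in> perfect_msrd_codes" "K = perfect_msrd_equiv `` {C}"
    by (rule quotientE)
  obtain Q e where e: "frob_frame Q" "e * (2 * e - 1) = 0" "C = trace_code Q e"
    using perfect_msrd_code_classification[OF assms(1) C(1)] .
  then have "(C, trace_code P e) \<in> perfect_msrd_equiv"
    using C(1) trace_code_perfect[OF P] code_equivalent_trace_code[OF _ P]
    by (simp add: perfect_msrd_equiv_def)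
  then show "K \<in> ?classes"
    using equiv_class_eq[OF equiv_perfect_msrd] C(2) e(2) by blast
qed

lemma card_perfect_msrd_quotient:
  assumes "2 < CARD('a::{field,finite})"
  shows "card ((perfect_msrd_codes :: ('a^3^3) set set) // perfect_msrd_equiv) =
    card {e :: 'a. e * (2 * e - 1) = 0}"
proof -
  obtain P :: "'a alg_closure^3^3" where P: "frob_frame P"
    using exists_frob_frame by blast
  show ?thesis
    unfolding perfect_msrd_quotient_eq[OF assms P]
    by (rule card_image[OF inj_on_trace_code_class[OF P]])
qed

theorem theorem3p28:
  fixes q :: nat
  assumes "q = CARD('a::{field,finite})"
  shows "(even q \<and> q > 2 \<longrightarrow>
            card ((perfect_msrd_codes :: ('a^3^3) set set) // perfect_msrd_equiv) = 1) \<and>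
         (odd q \<longrightarrow>
            card ((perfect_msrd_codes :: ('a^3^3) set set) // perfect_msrd_equiv) = 2)"
proof (intro conjI impI)
  assume "even q \<and> q > 2"
  then have "(2 :: 'a) = 0" "2 < CARD('a)"
    using assms even_CARD_iff[where 'a = 'a] by auto
  moreover from this have "{e :: 'a. e * (2 * e - 1) = 0} = {0}"
    by auto
  ultimately show "card ((perfect_msrd_codes :: ('a^3^3) set set) // perfect_msrd_equiv) = 1"
    by (simp add: card_perfect_msrd_quotient)
next
  assume "odd q"
  then have two: "(2 :: 'a) \<noteq> 0" and "2 < CARD('a)"
    using assms even_CARD_iff[where 'a = 'a] CARD_field_ge_2[where 'a = 'a]
    by (auto simp: le_less)
  moreover have "{e :: 'a. e * (2 * e - 1) = 0} = {0, 1 / 2}"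
    using two by (auto simp: field_simps)
  ultimately show "card ((perfect_msrd_codes :: ('a^3^3) set set) // perfect_msrd_equiv) = 2"
    by (simp add: card_perfect_msrd_quotient)
qed

end
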